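(* For any $P,P'\in\mathcal{P}_{k,n}$, one has $g_P(q)=g_{P'}(q)$.
   Context: Let $n\ge 1$, $0\le k\le n$, $[n]=\{1,\dots,n\}$. An $n$-periodic affine permutation is a bijection $f:\mathbb{Z}\to\mathbb{Z}$ with $f(i+n)=f(i)+n$ for all $i$. $\mathbf{B}_{k,n}$ is the set of those with $\frac1n\sum_{i=1}^n(f(i)-i)=k$ and $i\le f(i)\le i+n$ for all $i$. The length is $\ell(f)=\#\{(a,b): a\in[n],\,b\in\mathbb{Z},\,a<b,\,f(a)>f(b)\}$. Lattice paths: $\mathcal{P}_{k,n}$ is the set of lattice paths $P$ from $(0,0)$ to $(n-k,k)$ with unit steps $P_1,\dots,P_n\in\{\mathrm R,\mathrm U\}$ (right, up). Extend $P$ to a bi-infinite path with steps indexed by $\mathbb{Z}$ via $P_{i+n}=P_i$ (step $1$ starts at $(0,0)$); it is invariant under translation by $(n-k,k)$. The strip of $P$ is the region between the extended path $P$ (southern boundary) and its translate $P+(0,k)$ (northern boundary). On each boundary the unit edges are labeled by $\mathbb{Z}$: the southern edge labeled $i$ is step $i$ of $P$, and the northern edge labeled $i$ is its translate by $(0,k)$. Fillings: a periodic filling assigns to each unit box of the strip a crossing or an elbow, invariantly under translation by $(n-k,k)$. Strands enter at the northern boundary edges and travel right/down: in a crossing box a strand entering from the left exits right and one entering from the top exits at the bottom; in an elbow box a strand entering from the left exits at the bottom and one entering from the top exits right. Each strand ends at a southern boundary edge; the strand permutation sends $i$ to $j$ if the strand entering at northern edge $i$ exits at southern edge $j$. (If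 $k\in\{0,n\}$ the strip has no boxes and each strand exits at the edge where it enters.) $\operatorname{Deo}_{f,P}$ is the set of $(f,P)$-affine Deograms: periodic fillings with strand permutation $f$ such that whenever two strands form an elbow in a box, they have crossed each other an even number of times in boxes traversed before it (counting from the northern boundary). For $A\in\operatorname{Deo}_{f,P}$, $\#\mathrm{elbows}(A)$ and $\#\mathrm{crossings}(A)$ are counted modulo translation by $(n-k,k)$. Put $$R_{f,\tau_P}(q)=\sum_{A\in\operatorname{Deo}_{f,P}}(q-1)^{\#\mathrm{elbows}(A)}\,q^{(\#\mathrm{crossings}(A)-\ell(f))/2},\qquad g_P(q)=\sum_{f\in\mathbf{B}_{k,n}}R_{f,\tau_P}(q).$$ *)

theory Defs
  imports
    "HOL-Library.FuncSet"
    "HOL-Computational_Algebra.Formal_Laurent_Series"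
begin

section \<open>Bounded affine permutations\<close>

definition bounded_affine_perms :: "nat \<Rightarrow> nat \<Rightarrow> (int \<Rightarrow> int) set" where
  "bounded_affine_perms k n = {f. bij f \<and> (\<forall>i. f (i + int n) = f i + int n)
     \<and> (1 / real n) * (\<Sum>i = 1..int n. real_of_int (f i - i)) = real k
     \<and> (\<forall>i. i \<le> f i \<and> f i \<le> i + int n)}"

definition affine_length :: "nat \<Rightarrow> (int \<Rightarrow> int) \<Rightarrow> nat" where
  "affine_length n f = card {(a, b). a \<in> {1..int n} \<and> a < b \<and> f a > f b}"

section \<open>Lattice paths and their strips\<close>

datatype step = Right | Up

definition lattice_paths :: "nat \<Rightarrow> nat \<Rightarrow> step list set" where
  "lattice_paths k n = {P. length P = n \<and> count_list P Up = k \<and> count_list P Right = n - k}"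

text \<open>The translation vector \<open>(n - k, k)\<close> of a path is \<open>(width P, height P)\<close>.\<close>

definition width :: "step list \<Rightarrow> int" where
  "width P = int (count_list P Right)"

definition height :: "step list \<Rightarrow> int" where
  "height P = int (count_list P Up)"

text \<open>In the bi-infinite extension, step \<open>i\<close> leads from \<open>vertex P (i - 1)\<close> to \<open>vertex P i\<close>,
  and \<open>vertex P 0\<close> is the origin. Lists are indexed from 0, hence the shift in \<open>ext_step\<close>.\<close>

definition ext_step :: "step list \<Rightarrow> int \<Rightarrow> step" where
  "ext_step P i = P ! nat ((i - 1) mod int (length P))"

definition vertex :: "step list \<Rightarrow> int \<Rightarrow> int \<times> int" where
  "vertex P i =
     (let m = i div int (length P); Q = take (nat (i mod int (length P))) P
      in (m * width P + int (count_list Q Right), m * height P + int (count_list Q Up)))"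

text \<open>The triple \<open>(s, x, y)\<close> stands for the unit edge that starts at the point \<open>(x, y)\<close> and goes
  in direction \<open>s\<close>. The pair \<open>(x, y)\<close> stands for the unit box \<open>[x, x + 1] \<times> [y, y + 1]\<close>.\<close>

type_synonym edge = "step \<times> int \<times> int"
type_synonym box = "int \<times> int"

definition south_edge :: "step list \<Rightarrow> int \<Rightarrow> edge" where
  "south_edge P i = (ext_step P i, vertex P (i - 1))"

definition north_edge :: "step list \<Rightarrow> int \<Rightarrow> edge" where
  "north_edge P i = (case south_edge P i of (s, x, y) \<Rightarrow> (s, x, y + height P))"

text \<open>The two boundaries differ by a vertical translation, so the region between them consists, over
  each horizontal edge of the southern boundary, of the \<open>height P\<close> boxes above that edge.
  If all steps are \<open>Up\<close>, the boundaries coincide as sets and there are no boxes.\<close>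

definition strip :: "step list \<Rightarrow> box set" where
  "strip P = {(x, y). \<exists>i h. south_edge P i = (Right, x, h) \<and> h \<le> y \<and> y < h + height P}"

section \<open>Fillings and strands\<close>

datatype tile = Crossing | Elbow

text \<open>Fillings are extensional, that is, \<open>undefined\<close> outside of the strip, so that each filling is
  represented by exactly one function.\<close>

definition periodic_fillings :: "step list \<Rightarrow> (box \<Rightarrow> tile) set" where
  "periodic_fillings P = {A \<in> strip P \<rightarrow>\<^sub>E UNIV.
     \<forall>(x, y) \<in> strip P. A (x + width P, y + height P) = A (x, y)}"

text \<open>The box that a strand on a given edge is about to enter, moving right through a vertical edge
  and down through a horizontal one.\<close>

fun next_box :: "edge \<Rightarrow> box" where
  "next_box (Up, x, y) = (x, y)"
| "next_box (Right, x, y) = (x, y - 1)"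

text \<open>The edge through which a strand that enters \<open>next_box e\<close> through \<open>e\<close> leaves this box.\<close>

fun exit_edge :: "tile \<Rightarrow> edge \<Rightarrow> edge" where
  "exit_edge Crossing (Up, x, y) = (Up, x + 1, y)"
| "exit_edge Crossing (Right, x, y) = (Right, x, y - 1)"
| "exit_edge Elbow (Up, x, y) = (Right, x, y)"
| "exit_edge Elbow (Right, x, y) = (Up, x + 1, y - 1)"

text \<open>\<open>strand P A i bs e\<close>: the strand entering at northern edge \<open>i\<close> arrives at the edge \<open>e\<close> after
  traversing exactly the boxes \<open>bs\<close>, in this order.\<close>

inductive strand :: "step list \<Rightarrow> (box \<Rightarrow> tile) \<Rightarrow> int \<Rightarrow> box list \<Rightarrow> edge \<Rightarrow> bool"
  for P :: "step list" and A :: "box \<Rightarrow> tile" and i :: int where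
  strand_start: "strand P A i [] (north_edge P i)"
| strand_step: "strand P A i bs e \<Longrightarrow> next_box e \<in> strip P
    \<Longrightarrow> strand P A i (bs @ [next_box e]) (exit_edge (A (next_box e)) e)"

definition is_strand_perm :: "step list \<Rightarrow> (box \<Rightarrow> tile) \<Rightarrow> (int \<Rightarrow> int) \<Rightarrow> bool" where
  "is_strand_perm P A f \<longleftrightarrow> (\<forall>i. \<exists>bs. strand P A i bs (south_edge P (f i)))"

section \<open>Affine Deograms\<close>

text \<open>Two different strands that both traverse a crossing box cross each other there, since they
  enter it through different edges.\<close>

definition crossings_between :: "(box \<Rightarrow> tile) \<Rightarrow> box list \<Rightarrow> box list \<Rightarrow> nat" where
  "crossings_between A bs cs = card {b \<in> set bs \<inter> set cs. A b = Crossing}"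

definition Deograms :: "(int \<Rightarrow> int) \<Rightarrow> step list \<Rightarrow> (box \<Rightarrow> tile) set" where
  "Deograms f P = {A \<in> periodic_fillings P. is_strand_perm P A f \<and>
     (\<forall>i j bs cs d e. i \<noteq> j \<longrightarrow> strand P A i bs d \<longrightarrow> strand P A j cs e \<longrightarrow>
        next_box d = next_box e \<longrightarrow> next_box d \<in> strip P \<longrightarrow> A (next_box d) = Elbow \<longrightarrow>
        even (crossings_between A bs cs))}"

definition translation_rel :: "step list \<Rightarrow> (box \<times> box) set" where
  "translation_rel P = {((x, y), (x', y')). \<exists>m. x' = x + m * width P \<and> y' = y + m * height P}"

definition num_tiles :: "step list \<Rightarrow> tile \<Rightarrow> (box \<Rightarrow> tile) \<Rightarrow> nat" where
  "num_tiles P t A = card ({b \<in> strip P. A b = t} // translation_rel P)"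

text \<open>The exponent of \<open>q\<close> is a half of an integer, so we work with Laurent series in a
  formal variable \<open>X = q\<^sup>1\<^sup>/\<^sup>2\<close>: then \<open>q = X\<^sup>2\<close>, and \<open>q\<close> to the power \<open>c/2\<close> is \<open>X\<close> to the
  power \<open>c\<close>, for any integer \<open>c\<close>.\<close>

definition q_var :: "int fls" where
  "q_var = fls_X ^ 2"

definition q_half_power :: "int \<Rightarrow> int fls" where
  "q_half_power c = fls_X_intpow c"

definition R_poly :: "(int \<Rightarrow> int) \<Rightarrow> step list \<Rightarrow> int fls" where
  "R_poly f P = (\<Sum>A \<in> Deograms f P. (q_var - 1) ^ num_tiles P Elbow A *
     q_half_power (int (num_tiles P Crossing A) - int (affine_length (length P) f)))"

definition g_poly :: "step list \<Rightarrow> int fls" where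
  "g_poly P = (\<Sum>f \<in> bounded_affine_perms (count_list P Up) (length P). R_poly f P)"

end

theory Submission
  imports Defs
begin

text \<open>In fact \<open>g_P(q) = q\<^bsup>k(n-k)\<^esup>\<close>. Every filling has a strand permutation in
  \<open>B\<^bsub>k,n\<^esub>\<close>, so \<open>g_P\<close> sums over all Deograms. Call a box rising if the strand entering it from the
  left has a smaller label than the one entering from the top. Two strands have crossed an even number
  of times before meeting in a box iff the box is rising, so the Deograms are the fillings with elbows
  in rising boxes only. For two strands that are out of order at the end, the crossings in rising boxes
  exceed the others by one, and otherwise the two kinds are equally many; hence the number of crossings
  minus the length is twice the number of crossings in non-rising boxes. The summand of a filling
  therefore is a product of local weights: a rising box contributes \<open>q - 1\<close> for an elbow and \<open>1\<close> for a
  crossing, any other box \<open>0\<close> and \<open>q\<close>, in total \<open>q\<close> in both cases. Whether a box is rising depends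
  only on the boxes before it, so the sum factorises over the \<open>k(n - k)\<close> boxes modulo translation.\<close>

section \<open>Orbits and local weights\<close>

lemma translation_class_shift:
  "translation_rel P `` {(x + m * width P, y + m * height P)} = translation_rel P `` {(x, y)}"
proof -
  have "(\<exists>m'. x' = x + m * width P + m' * width P \<and> y' = y + m * height P + m' * height P) \<longleftrightarrow>
        (\<exists>m'. x' = x + m' * width P \<and> y' = y + m' * height P)" (is "?L \<longleftrightarrow> ?R") for x' y'
  proof
    assume ?L then obtain m' where "x' = x + m * width P + m' * width P" "y' = y + m * height P + m' * height P" by blast
    then show ?R by (intro exI[of _ "m + m'"]) (simp add: algebra_simps)
  next
    assume ?R then obtain m' where "x' = x + m' * width P" "y' = y + m' * height P" by blast
    then show ?L by (intro exI[of _ "m' - m"]) (simp add: algebra_simps)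
  qed
  then show ?thesis by (auto simp: translation_rel_def)
qed

text \<open>Each translation raises \<open>\<phi>\<close> by \<open>c\<close>, so every orbit in
  \<open>S\<close> has exactly one box whose value lies in a given window of length
  \<open>c\<close>. Different choices of \<open>\<phi>\<close> thus count the same orbits in
  different ways.\<close>

lemma card_translation_classes:
  fixes \<phi> :: "box \<Rightarrow> int"
  assumes c: "c > 0"
    and S: "\<And>x y m. (x, y) \<in> S \<Longrightarrow> (x + m * width P, y + m * height P) \<in> S"
    and \<phi>: "\<And>x y m. (x, y) \<in> S \<Longrightarrow> \<phi> (x + m * width P, y + m * height P) = \<phi> (x, y) + m * c"
  shows "card (S // translation_rel P) = card {b \<in> S. l \<le> \<phi> b \<and> \<phi> b < l + c}"
proof -
  let ?F = "{b \<in> S. l \<le> \<phi> b \<and> \<phi> b < l + c}"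
  let ?cl = "\<lambda>b. translation_rel P `` {b}"
  have "inj_on ?cl ?F"
  proof (rule inj_onI)
    fix b b' assume b: "b \<in> ?F" and b': "b' \<in> ?F" and eq: "?cl b = ?cl b'"
    obtain x y where xy: "b = (x, y)" by fastforce
    have "b' \<in> ?cl b'" by (cases b') (auto simp: translation_rel_def intro: exI[of _ 0])
    with eq xy obtain m where m: "b' = (x + m * width P, y + m * height P)"
      by (auto simp: translation_rel_def)
    have "\<phi> b' = \<phi> b + m * c" using \<phi> b xy m by auto
    then have "m * c < c" "- c < m * c" using b b' unfolding mem_Collect_eq by linarith+
    then have "\<bar>m\<bar> * \<bar>c\<bar> < \<bar>c\<bar>" using c unfolding abs_mult [symmetric] by linarith
    then have "m = 0" using c mult_less_cancel_right2[of "\<bar>m\<bar>" "\<bar>c\<bar>"] by linarith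
    then show "b = b'" using m xy by simp
  qed
  moreover have "?cl ` ?F = S // translation_rel P"
  proof
    show "?cl ` ?F \<subseteq> S // translation_rel P" by (auto simp: quotient_def)
    show "S // translation_rel P \<subseteq> ?cl ` ?F"
    proof
      fix C assume "C \<in> S // translation_rel P"
      then obtain x y where xy: "(x, y) \<in> S" "C = ?cl (x, y)" by (auto simp: quotient_def)
      \<comment> \<open>This translation brings \<open>\<phi>\<close> to \<open>l\<close> plus a
        remainder modulo \<open>c\<close>, hence into the window.\<close>
      define m where "m = - ((\<phi> (x, y) - l) div c)"
      let ?b = "(x + m * width P, y + m * height P)"
      have "?b \<in> S" using S xy by blast
      moreover have "\<phi> ?b = l + (\<phi> (x, y) - l) mod c"
        using \<phi>[OF xy(1), of m] by (simp add: m_def minus_div_mult_eq_mod [symmetric])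
      ultimately have "?b \<in> ?F" using c by simp
      moreover have "C = ?cl ?b" using xy translation_class_shift by simp
      ultimately show "C \<in> ?cl ` ?F" by blast
    qed
  qed
  ultimately have "bij_betw ?cl ?F (S // translation_rel P)" by (simp add: bij_betw_def)
  then show ?thesis using bij_betw_same_card by fastforce
qed

section \<open>Sums of products of weights that depend on earlier boxes\<close>

lemma UNIV_tile: "(UNIV :: tile set) = {Crossing, Elbow}"
  by (auto intro: tile.exhaust)

text \<open>The tile of a box of maximal rank influences no value of \<open>u\<close>, so summing
  over this tile first gives a factor \<open>q\<close>, whatever the other tiles are.\<close>

lemma sum_prod_dependent_weights:
  fixes w :: "bool \<Rightarrow> tile \<Rightarrow> 'r::comm_ring_1" and rank :: "'b \<Rightarrow> int"
  assumes "finite B"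
    and "\<And>A A' b. b \<in> B \<Longrightarrow> (\<And>c. c \<in> B \<Longrightarrow> rank c < rank b \<Longrightarrow> A c = A' c) \<Longrightarrow> u A b = u A' b"
    and w: "\<And>c. w c Crossing + w c Elbow = q"
  shows "(\<Sum>A \<in> B \<rightarrow>\<^sub>E UNIV. \<Prod>b\<in>B. w (u A b) (A b)) = q ^ card B"
  using assms(1,2)
proof (induction B rule: finite_ranking_induct[where f = rank])
  case empty
  then show ?case by simp
next
  case (insert b B)
  show ?case
  \<comment> \<open>The induction rule also covers the insertion of an element that is already
    present.\<close>
  proof (cases "b \<in> B")
    case True
    then have eq: "insert b B = B" by blast
    show ?thesis unfolding eq by (rule insert.IH, rule insert.prems[unfolded eq])
  next
    case [simp]: False
    \<comment> \<open>The value of \<open>u\<close> at a box looks only at strictly smaller ranks,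
      so boxes tied with \<open>b\<close> are unaffected too.\<close>
    have u: "u (A(b := t)) c = u A c" if "c \<in> insert b B" for A t c
      by (rule insert.prems) (use that insert.hyps(2) in \<open>auto simp: not_less dest!: leD\<close>)
    have "(\<Sum>A \<in> insert b B \<rightarrow>\<^sub>E UNIV. \<Prod>c\<in>insert b B. w (u A c) (A c)) =
       (\<Sum>(t, A) \<in> UNIV \<times> (B \<rightarrow>\<^sub>E UNIV). \<Prod>c\<in>insert b B. w (u (A(b := t)) c) ((A(b := t)) c))"
      unfolding PiE_insert_eq
      by (subst sum.reindex[OF inj_combinator[OF False]]) (simp add: case_prod_unfold)
    also have "\<dots> = (\<Sum>(t, A) \<in> UNIV \<times> (B \<rightarrow>\<^sub>E UNIV). w (u A b) t * (\<Prod>c\<in>B. w (u A c) (A c)))"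
    proof (intro sum.cong refl, clarify)
      fix t A
      have "(\<Prod>c\<in>B. w (u (A(b := t)) c) ((A(b := t)) c)) = (\<Prod>c\<in>B. w (u A c) (A c))"
        by (intro prod.cong) (use u in auto)
      then show "(\<Prod>c\<in>insert b B. w (u (A(b := t)) c) ((A(b := t)) c)) = w (u A b) t * (\<Prod>c\<in>B. w (u A c) (A c))"
        using insert.hyps(1) u[of b A t] by simp
    qed
    also have "\<dots> = (\<Sum>A \<in> B \<rightarrow>\<^sub>E UNIV. (\<Sum>t\<in>UNIV. w (u A b) t) * (\<Prod>c\<in>B. w (u A c) (A c)))"
      unfolding sum.cartesian_product [symmetric]
      by (subst sum.swap) (simp add: sum_distrib_right)
    also have "\<dots> = q * (\<Sum>A \<in> B \<rightarrow>\<^sub>E UNIV. \<Prod>c\<in>B. w (u A c) (A c))"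
      using w by (simp add: UNIV_tile sum_distrib_left)
    also have "(\<Sum>A \<in> B \<rightarrow>\<^sub>E UNIV. \<Prod>c\<in>B. w (u A c) (A c)) = q ^ card B"
    proof (rule insert.IH)
      fix A A' :: "'b \<Rightarrow> tile" and c assume c: "c \<in> B" and eq: "\<And>d. d \<in> B \<Longrightarrow> rank d < rank c \<Longrightarrow> A d = A' d"
      show "u A c = u A' c"
      proof (rule insert.prems)
        show "c \<in> insert b B" using c by simp
        fix d assume "d \<in> insert b B" "rank d < rank c"
        then show "A d = A' d" using eq insert.hyps(2)[OF c] by auto
      qed
    qed
    finally show ?thesis using insert.hyps(1) by simp
  qed
qed

section \<open>Edges, boxes and their translations\<close>

fun prev_box :: "edge \<Rightarrow> box" where
  "prev_box (Up, x, y) = (x - 1, y)"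
| "prev_box (Right, x, y) = (x, y)"

text \<open>The antidiagonal on which the edge starts. An elbow preserves it; a crossing adds 1 for
  the strand from the left and subtracts 1 for the strand from the top. It serves to order the
  strands.\<close>

fun pos :: "edge \<Rightarrow> int" where
  "pos (s, x, y) = x + y"

fun shift_edge :: "step list \<Rightarrow> int \<Rightarrow> edge \<Rightarrow> edge" where
  "shift_edge P m (s, x, y) = (s, x + m * width P, y + m * height P)"

fun shift_box :: "step list \<Rightarrow> int \<Rightarrow> box \<Rightarrow> box" where
  "shift_box P m (x, y) = (x + m * width P, y + m * height P)"

lemma prev_box_exit_edge [simp]: "prev_box (exit_edge t e) = next_box e"
  by (cases "(t, e)" rule: exit_edge.cases) auto

lemma exit_edge_inj: "exit_edge t e = exit_edge t e' \<Longrightarrow> e = e'"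
  by (cases "(t, e)" rule: exit_edge.cases; cases "(t, e')" rule: exit_edge.cases) auto

lemma next_box_eq_iff: "next_box e = (x, y) \<longleftrightarrow> e = (Up, x, y) \<or> e = (Right, x, y + 1)"
  by (cases e rule: next_box.cases) auto

lemma shift_edge_simps [simp]:
  "next_box (shift_edge P m e) = shift_box P m (next_box e)"
  "exit_edge t (shift_edge P m e) = shift_edge P m (exit_edge t e)"
  "pos (shift_edge P m e) = pos e + m * (width P + height P)"
  by (cases "(t, e)" rule: exit_edge.cases; simp add: algebra_simps)+

lemma exit_edge_surj:
  obtains e where "exit_edge t e = e'" "next_box e = prev_box e'"
proof -
  have "\<exists>e. exit_edge t e = e' \<and> next_box e = prev_box e'"
  proof (cases e' rule: prev_box.cases)
    case (1 x y)
    show ?thesis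
      by (cases t) (rule exI[of _ "(Up, x - 1, y)"] exI[of _ "(Right, x - 1, y + 1)"]; use 1 in simp)+
  next
    case (2 x y)
    show ?thesis
      by (cases t) (rule exI[of _ "(Right, x, y + 1)"] exI[of _ "(Up, x, y)"]; use 2 in simp)+
  qed
  then show ?thesis using that by blast
qed

lemma edge_pair_simps [simp]:
  "pos (s, b) = fst b + snd b" "next_box (Up, b) = b"
  "exit_edge Crossing (Up, b) = (Up, fst b + 1, snd b)"
  by (cases b; simp)+

lemma next_prev_box_mono: "fst (prev_box e) \<le> fst (next_box e)" "snd (next_box e) \<le> snd (prev_box e)"
  by (cases e rule: prev_box.cases; simp)+

lemma shift_box_add: "shift_box P m (shift_box P m' b) = shift_box P (m + m') b"
  by (cases b) (simp add: algebra_simps)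

lemma shift_box_0 [simp]: "shift_box P 0 b = b"
  by (cases b) simp

lemma shift_edge_Pair: "shift_edge P m (s, b) = (s, shift_box P m b)"
  by (cases b) simp

section \<open>Finiteness of the set of bounded affine permutations\<close>

lemma affine_shift:
  fixes f :: "int \<Rightarrow> int"
  assumes "\<And>i. f (i + n) = f i + n"
  shows "f (i + m * n) = f i + m * n"
proof (induction m rule: int_induct[where k = 0])
  case (step1 m)
  then show ?case using assms[of "i + m * n"] by (simp add: algebra_simps)
next
  case (step2 m)
  then show ?case using assms[of "i + (m - 1) * n"] by (simp add: algebra_simps)
qed simp

text \<open>Periodicity lets the values on one period determine the permutation, and boundedness
  leaves finitely many choices for these values.\<close>

lemma finite_bounded_affine_perms:
  assumes "n \<ge> 1"
  shows "finite (bounded_affine_perms k n)"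
proof -
  let ?r = "\<lambda>f :: int \<Rightarrow> int. restrict f {1..int n}"
  have "?r ` bounded_affine_perms k n \<subseteq> {1..int n} \<rightarrow>\<^sub>E {1..2 * int n}"
  proof (clarsimp simp: bounded_affine_perms_def)
    fix f :: "int \<Rightarrow> int" and i
    assume "\<forall>i. i \<le> f i \<and> f i \<le> i + int n" "1 \<le> i" "i \<le> int n"
    then show "1 \<le> f i \<and> f i \<le> 2 * int n" by (smt (verit))
  qed
  then have "finite (?r ` bounded_affine_perms k n)"
    by (rule finite_subset) (simp add: finite_PiE)
  moreover have "inj_on ?r (bounded_affine_perms k n)"
  proof (intro inj_onI ext)
    fix f g i assume fg: "f \<in> bounded_affine_perms k n" "g \<in> bounded_affine_perms k n" "?r f = ?r g"
    define j m where "j = (i - 1) mod int n + 1" and "m = (i - 1) div int n"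
    have i: "i = j + m * int n" by (simp add: j_def m_def)
    have "0 \<le> (i - 1) mod int n" "(i - 1) mod int n < int n" using assms by simp_all
    then have "j \<in> {1..int n}" unfolding j_def atLeastAtMost_iff by linarith
    then have "f j = g j" using fg(3) by (metis restrict_apply')
    moreover have "f (j + m * int n) = f j + m * int n" "g (j + m * int n) = g j + m * int n"
      using fg by (auto intro!: affine_shift simp: bounded_affine_perms_def)
    ultimately show "f i = g i" by (simp add: i)
  qed
  ultimately show ?thesis by (rule finite_imageD)
qed

section \<open>Frontiers\<close>

text \<open>Edges are oriented the way strands traverse them, out of \<open>S\<close> to the right
  or downwards.\<close>

definition frontier :: "box set \<Rightarrow> edge set" where
  "frontier S = {e. prev_box e \<in> S \<and> next_box e \<notin> S}"

definition upleft_closed :: "box set \<Rightarrow> bool" where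
  "upleft_closed S \<longleftrightarrow> (\<forall>x y x' y'. (x, y) \<in> S \<longrightarrow> x' \<le> x \<longrightarrow> y \<le> y' \<longrightarrow> (x', y') \<in> S)"

lemma upleft_closedD: "upleft_closed S \<Longrightarrow> (x, y) \<in> S \<Longrightarrow> x' \<le> x \<Longrightarrow> y \<le> y' \<Longrightarrow> (x', y') \<in> S"
  unfolding upleft_closed_def by blast

lemma prev_box_in_upleft_closed: "upleft_closed S \<Longrightarrow> next_box e \<in> S \<Longrightarrow> prev_box e \<in> S"
  by (cases e rule: prev_box.cases) (auto elim!: upleft_closedD)

text \<open>The frontier of an up-left closed set is a staircase going right and up, so at most one
  of its edges starts on each antidiagonal.\<close>

lemma frontier_pos_inj:
  assumes "upleft_closed S" "e \<in> frontier S" "e' \<in> frontier S" "pos e = pos e'"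
  shows "e = e'"
proof -
  note D = upleft_closedD[OF assms(1)]
  have UU: "y \<le> y'" if "(Up, x, y) \<in> frontier S" "(Up, x', y') \<in> frontier S" "x + y = x' + y'" for x y x' y' :: int
    using that D[of "x' - 1" y' x y] by (force simp: frontier_def)
  have RR: "y \<le> y'" if "(Right, x, y) \<in> frontier S" "(Right, x', y') \<in> frontier S" "x + y = x' + y'" for x y x' y' :: int
    using that D[of x' y' x "y - 1"] by (force simp: frontier_def)
  have UR: False if "(Up, x, y) \<in> frontier S" "(Right, x', y') \<in> frontier S" "x + y = x' + y'" for x y x' y' :: int
    using that D[of "x - 1" y x' "y' - 1"] D[of x' y' x y] by (cases "y < y'") (auto simp: frontier_def)
  obtain s x y s' x' y' where e: "e = (s, x, y)" "e' = (s', x', y')" by (metis prod_cases3)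
  show ?thesis
  proof (cases s; cases s')
    assume "s = Up" "s' = Up"
    then show ?thesis using UU[of x y x' y'] UU[of x' y' x y] e assms by auto
  next
    assume "s = Right" "s' = Right"
    then show ?thesis using RR[of x y x' y'] RR[of x' y' x y] e assms by auto
  qed (use UR[of x y x' y'] UR[of x' y' x y] e assms in auto)
qed

section \<open>The strip of a path\<close>

text \<open>The cases \<open>k = 0\<close> and \<open>k = n\<close> are left out here; each of them
  has only one path. Positive width and height make \<open>rank\<close> below increase strictly
  along strands.\<close>

locale proper_path =
  fixes P :: "step list"
  assumes up_pos: "count_list P Up > 0" and right_pos: "count_list P Right > 0"
begin

abbreviation "W \<equiv> width P"
abbreviation "K \<equiv> height P"
abbreviation "N \<equiv> int (length P)"
abbreviation "X i \<equiv> fst (vertex P i)"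
abbreviation "Y i \<equiv> snd (vertex P i)"

lemma W_pos [simp]: "W > 0" and K_pos [simp]: "K > 0"
  using up_pos right_pos by (auto simp: width_def height_def)

section \<open>Coordinates of the extended path\<close>

lemma count_steps: "count_list xs Right + count_list xs Up = length xs"
  by (induction xs) (auto, metis step.exhaust)

lemma N_eq: "N = W + K"
  using count_steps[of P] by (simp add: width_def height_def)

lemma N_pos [simp]: "N > 0" using N_eq W_pos K_pos by linarith

text \<open>Admitting \<open>r = length P\<close>, the end of a period, lets
  \<open>vertex_Suc\<close> treat the last step of a period like any other.\<close>

lemma vertex_eq:
  assumes "r \<le> length P"
  shows "vertex P (m * N + int r) =
    (m * W + int (count_list (take r P) Right), m * K + int (count_list (take r P) Up))"
proof (cases "r = length P")
  case True
  then have "m * N + int r = (m + 1) * N" by (simp add: algebra_simps)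
  then show ?thesis using True N_pos
    by (simp add: vertex_def width_def height_def Let_def algebra_simps)
next
  case False
  then have "(m * N + int r) div N = m" "(m * N + int r) mod N = int r"
    using assms N_pos by (simp_all add: div_add1_eq mod_pos_pos_trivial div_pos_pos_trivial)
  then show ?thesis by (simp add: vertex_def Let_def)
qed

lemma int_split:
  obtains m r where "i = m * N + int r" "r < length P"
proof
  show "i = (i div N) * N + int (nat (i mod N))" using N_pos by simp
  show "nat (i mod N) < length P" using N_pos by (simp add: nat_less_iff)
qed

lemma vertex_Suc:
  "vertex P i = (if ext_step P i = Right then (X (i - 1) + 1, Y (i - 1)) else (X (i - 1), Y (i - 1) + 1))"
proof -
  obtain m r where r: "i - 1 = m * N + int r" "r < length P" by (rule int_split)
  then have i: "i = m * N + int (Suc r)" by simp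
  have "(i - 1) mod N = int r" using r by simp
  then have e: "ext_step P i = P ! r" by (simp add: ext_step_def)
  have t: "take (Suc r) P = take r P @ [P ! r]" using r by (simp add: take_Suc_conv_app_nth)
  show ?thesis
    using vertex_eq[of r m] vertex_eq[of "Suc r" m] r i e t
    by (cases "P ! r") (simp_all)
qed

text \<open>Each step raises the coordinate sum by one, so vertex \<open>i\<close> is the point of
  the path on antidiagonal \<open>i\<close>, and \<open>X\<close> alone describes the path.\<close>

lemma X_plus_Y: "X i + Y i = i"
proof -
  obtain m r where r: "i = m * N + int r" "r < length P" by (rule int_split)
  then show ?thesis using vertex_eq[of r m] count_steps[of "take r P"] N_eq
    by (simp add: algebra_simps min_def)
qed

lemma vertex_shift: "vertex P (i + m * N) = (X i + m * W, Y i + m * K)"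
proof -
  obtain m' r where r: "i = m' * N + int r" "r < length P" by (rule int_split)
  then have "i + m * N = (m' + m) * N + int r" by (simp add: algebra_simps)
  then show ?thesis using vertex_eq[of r m'] vertex_eq[of r "m' + m"] r
    by (simp add: algebra_simps)
qed

lemma X_step: "X (i - 1) \<le> X i" "X i \<le> X (i - 1) + 1"
  using vertex_Suc[of i] by auto

lemma X_mono: "i \<le> j \<Longrightarrow> X i \<le> X j"
proof (induction j rule: int_ge_induct)
  case (step j)
  then show ?case using X_step(1)[of "j + 1"] by simp
qed simp

lemma Y_mono: "i \<le> j \<Longrightarrow> Y i \<le> Y j"
proof (induction j rule: int_ge_induct)
  case (step j)
  then show ?case using X_step(2)[of "j + 1"] X_plus_Y[of j] X_plus_Y[of "j + 1"] by simp
qed simp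

lemma ext_step_iff: "ext_step P i = Right \<longleftrightarrow> X i = X (i - 1) + 1" "ext_step P i = Up \<longleftrightarrow> X i = X (i - 1)"
  using vertex_Suc[of i] by (cases "ext_step P i"; auto)+

lemma ext_step_shift: "ext_step P (i + m * N) = ext_step P i"
proof -
  have "i + m * N - 1 = (i - 1) + m * N" by simp
  then show ?thesis unfolding ext_step_def by (metis mod_mult_self1)
qed

lemma south_edge_eq: "south_edge P i = (ext_step P i, X (i - 1), i - 1 - X (i - 1))"
  using X_plus_Y[of "i - 1"] by (simp add: south_edge_def prod_eq_iff)

lemma north_edge_eq: "north_edge P i = (ext_step P i, X (i - 1), i - 1 - X (i - 1) + K)"
  by (simp add: north_edge_def south_edge_eq)

lemma north_edge_shift: "north_edge P (i + m * N) = shift_edge P m (north_edge P i)"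
proof -
  have "i + m * N - 1 = (i - 1) + m * N" by simp
  then have "X (i + m * N - 1) = X (i - 1) + m * W"
    using vertex_shift[of "i - 1" m] by (simp only: fst_conv)
  then show ?thesis using ext_step_shift[of i m]
    by (simp add: north_edge_eq) (simp add: N_eq algebra_simps)
qed

text \<open>A discrete intermediate value theorem: \<open>X\<close> rises by at most one per
  step.\<close>

lemma X_crossing:
  assumes "X a \<le> x" "x < X b"
  obtains i where "a < i" "i \<le> b" "X (i - 1) = x" "X i = x + 1"
proof -
  have "a \<le> b" using assms X_mono[of b a] by linarith
  then have "x < X b \<Longrightarrow> \<exists>i. a < i \<and> i \<le> b \<and> X (i - 1) = x \<and> X i = x + 1"
  proof (induction b rule: int_ge_induct)
    case base
    then show ?case using assms by simp
  next
    case (step b)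
    show ?case
    proof (cases "x < X b")
      case True
      then show ?thesis using step.IH by force
    next
      case False
      then show ?thesis using step X_step(2)[of "b + 1"] by (intro exI[of _ "b + 1"]) auto
    qed
  qed
  then show ?thesis using that assms by blast
qed

text \<open>The opposite corners \<open>(x, y + 1)\<close> and \<open>(x + 1, y)\<close> of a box lie on one antidiagonal, so
  comparing the vertex of a path on this antidiagonal with them tells on which side of the path the
  box lies. The set below consists of the boxes to the north-west of the path \<open>P + (0, c)\<close>.\<close>

definition north_west :: "int \<Rightarrow> box set" where
  "north_west c = {(x, y). x < X (x + y + 1 - c)}"

text \<open>Between the indices \<open>x + y + 1 - K\<close> and \<open>x + y + 1\<close>,
  \<open>X\<close> passes from \<open>x\<close> to \<open>x + 1\<close> at some step; this step is
  the southern edge below the box \<open>(x, y)\<close>.\<close>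

lemma strip_eq: "strip P = north_west 0 - north_west K"
proof -
  have "(\<exists>i h. south_edge P i = (Right, x, h) \<and> h \<le> y \<and> y < h + K) \<longleftrightarrow>
     X (x + y + 1 - K) \<le> x \<and> x < X (x + y + 1)" (is "?L \<longleftrightarrow> ?R") for x y
  proof
    assume ?L
    then obtain i where i: "ext_step P i = Right" "x = X (i - 1)" "i - 1 - x \<le> y" "y < i - 1 - x + K"
      by (auto simp: south_edge_eq)
    then show ?R using ext_step_iff[of i] X_mono[of i "x + y + 1"] X_mono[of "x + y + 1 - K" "i - 1"] by auto
  next
    assume ?R
    then obtain i where "x + y + 1 - K < i" "i \<le> x + y + 1" "X (i - 1) = x" "X i = x + 1"
      using X_crossing by metis
    then show ?L using ext_step_iff[of i] by (intro exI[of _ i] exI[of _ "i - 1 - x"]) (simp add: south_edge_eq)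
  qed
  then show ?thesis by (auto simp: strip_def north_west_def)
qed

lemma X_lipschitz: "i \<le> j \<Longrightarrow> X j \<le> X i + (j - i)"
  using Y_mono[of i j] X_plus_Y[of i] X_plus_Y[of j] by linarith

text \<open>Moving a box left by some distance lowers the value of \<open>X\<close> by at most that
  distance, and moving it up does not lower it.\<close>

lemma upleft_closed_north_west: "upleft_closed (north_west c)"
  unfolding upleft_closed_def north_west_def
proof (clarsimp)
  fix x y x' y' assume a: "x < X (x + y + 1 - c)" "x' \<le> x" "y \<le> y'"
  have "X (x + y + 1 - c) \<le> X (x' + y + 1 - c) + (x - x')"
    using X_lipschitz[of "x' + y + 1 - c" "x + y + 1 - c"] a by simp
  moreover have "X (x' + y + 1 - c) \<le> X (x' + y' + 1 - c)" by (rule X_mono) (use a in simp)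
  ultimately show "x' < X (x' + y' + 1 - c)" using a by linarith
qed

lemma frontier_north_west:
  "frontier (north_west c) = range (\<lambda>i. (ext_step P i, X (i - 1), i - 1 - X (i - 1) + c))"
proof (intro set_eqI iffI)
  fix e assume e: "e \<in> frontier (north_west c)"
  obtain s x y where xy: "e = (s, x, y)" by (metis prod_cases3)
  \<comment> \<open>Edge \<open>i\<close> of the path shifted up by \<open>c\<close> starts on
    antidiagonal \<open>i - 1 + c\<close>, so its label can be read off from its starting
    point.\<close>
  define i where "i = x + y + 1 - c"
  have i: "x + y - c = i - 1" by (simp add: i_def)
  have "ext_step P i = s \<and> X (i - 1) = x"
    using e xy X_step[of i] i ext_step_iff[of i] by (cases s) (auto simp: frontier_def north_west_def i_def)
  then show "e \<in> range (\<lambda>i. (ext_step P i, X (i - 1), i - 1 - X (i - 1) + c))"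
    using xy by (intro image_eqI[of _ _ i]) (auto simp: i_def)
next
  fix e assume "e \<in> range (\<lambda>i. (ext_step P i, X (i - 1), i - 1 - X (i - 1) + c))"
  then obtain i where "e = (ext_step P i, X (i - 1), i - 1 - X (i - 1) + c)" by blast
  then show "e \<in> frontier (north_west c)"
    using ext_step_iff[of i] by (cases "ext_step P i") (auto simp: frontier_def north_west_def)
qed

lemma frontier_north: "frontier (north_west K) = range (north_edge P)"
  unfolding frontier_north_west north_edge_eq ..

lemma frontier_south: "frontier (north_west 0) = range (south_edge P)"
  unfolding frontier_north_west south_edge_eq by simp

lemma strip_shift: "shift_box P m b \<in> strip P \<longleftrightarrow> b \<in> strip P"
proof (cases b)
  case (Pair x y)
  have "x + m * W + (y + m * K) + 1 = (x + y + 1) + m * N"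
    "x + m * W + (y + m * K) + 1 - K = (x + y + 1 - K) + m * N"
    using N_eq by (simp_all add: algebra_simps)
  then have "X (x + m * W + (y + m * K) + 1) = X (x + y + 1) + m * W"
    "X (x + m * W + (y + m * K) + 1 - K) = X (x + y + 1 - K) + m * W"
    by (simp_all only: vertex_shift fst_conv)
  then show ?thesis
    by (simp add: strip_eq north_west_def Pair)
qed

text \<open>This linear functional is invariant under translation by \<open>(W, K)\<close> and increases along every
  strand; it serves as the time at which a box is traversed.\<close>

fun rank :: "box \<Rightarrow> int" where
  "rank (x, y) = K * x - W * y"

lemma rank_shift [simp]: "rank (shift_box P m b) = rank b"
  by (cases b) (simp add: algebra_simps)

section \<open>A fundamental domain and the range of the rank\<close>

definition cell :: "box set" where
  "cell = {b \<in> strip P. 0 \<le> fst b \<and> fst b < W}"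

text \<open>Each column \<open>x\<close> of the period has exactly one horizontal southern edge,
  here labeled \<open>I x\<close>, with \<open>K\<close> boxes above it.\<close>

lemma card_cell: "card cell = count_list P Right * count_list P Up"
  and finite_cell: "finite cell"
proof -
  have "\<exists>i. X (i - 1) = x \<and> X i = x + 1" if "0 \<le> x" "x < W" for x
  proof -
    have "X 0 = 0" "X N = W" using vertex_eq[of 0 0] vertex_eq[of "length P" 0] by (simp_all add: width_def)
    then show ?thesis using that X_crossing[of 0 x N] by metis
  qed
  then obtain I where I: "X (I x - 1) = x" "X (I x) = x + 1" if "0 \<le> x" "x < W" for x by metis
  have eq: "cell = (SIGMA x : {0..<W}. {I x - 1 - x..<I x - 1 - x + K})"
  proof -
    have "X (x + y + 1 - K) \<le> x \<and> x < X (x + y + 1) \<longleftrightarrow> I x - 1 - x \<le> y \<and> y < I x - 1 - x + K"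
      (is "?L \<longleftrightarrow> ?R") if "0 \<le> x" "x < W" for x y
    proof
      assume ?L
      then show ?R using I[OF that] X_mono[of "x + y + 1" "I x - 1"] X_mono[of "I x" "x + y + 1 - K"] by force
    next
      assume ?R
      then show ?L using I[OF that] X_mono[of "I x" "x + y + 1"] X_mono[of "x + y + 1 - K" "I x - 1"] by force
    qed
    then have "(x, y) \<in> cell \<longleftrightarrow> (x, y) \<in> (SIGMA x : {0..<W}. {I x - 1 - x..<I x - 1 - x + K})" for x y
      by (simp add: cell_def strip_eq north_west_def not_less) blast
    then show ?thesis by auto
  qed
  show "finite cell" unfolding eq by simp
  show "card cell = count_list P Right * count_list P Up"
  proof -
    have "card cell = (\<Sum>x\<in>{0..<W}. nat K)" unfolding eq by (subst card_SigmaI) simp_all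
    then show ?thesis by (simp add: width_def height_def)
  qed
qed

lemma shift_into_cell: "b \<in> strip P \<Longrightarrow> shift_box P (- (fst b div W)) b \<in> cell"
  unfolding cell_def
  by (simp only: strip_shift mem_Collect_eq) (cases b, simp add: minus_div_mult_eq_mod)

text \<open>Since \<open>rank\<close> is invariant under translation, its values on the infinite
  strip are those on the finite set \<open>cell\<close>; finitely many stages therefore exhaust the
  strip.\<close>

definition start_time :: int where
  "start_time = Min (rank ` cell)"

definition duration :: nat where
  "duration = nat (Max (rank ` cell) + 1 - start_time)"

lemma rank_bounds:
  assumes "b \<in> strip P"
  shows "start_time \<le> rank b" "rank b < start_time + int duration"
proof -
  have "rank b \<in> rank ` cell" using shift_into_cell[OF assms] by (metis image_eqI rank_shift)
  then have *: "start_time \<le> rank b" "rank b \<le> Max (rank ` cell)"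
    using finite_cell by (auto simp: start_time_def)
  then show "start_time \<le> rank b" "rank b < start_time + int duration" by (simp_all add: duration_def)
qed

section \<open>Evolution of the strands\<close>

lemma rank_mono: "x' \<le> x \<Longrightarrow> y \<le> y' \<Longrightarrow> rank (x', y') \<le> rank (x, y)"
  unfolding rank.simps by (intro diff_mono mult_left_mono) (simp_all add: less_imp_le)

lemma rank_prev_less_next: "rank (prev_box e) < rank (next_box e)"
  using W_pos K_pos by (cases e rule: prev_box.cases) (simp_all add: rank.simps algebra_simps)

declare rank.simps [simp del]

text \<open>Before stage \<open>m\<close>, the strands sit on the edges of the south-eastern boundary of this set.\<close>

definition processed :: "nat \<Rightarrow> box set" where
  "processed m = north_west K \<union> {b \<in> north_west 0. rank b < start_time + int m}"

lemma upleft_closed_processed: "upleft_closed (processed m)"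
  unfolding upleft_closed_def
proof (intro allI impI)
  fix x y x' y' assume "(x, y) \<in> processed m" "x' \<le> x" "y \<le> y'"
  then show "(x', y') \<in> processed m"
    using upleft_closedD[OF upleft_closed_north_west, of x y K x' y']
      upleft_closedD[OF upleft_closed_north_west, of x y 0 x' y'] rank_mono[of x' x y y']
    by (auto simp: processed_def)
qed

lemma north_west_subset: "north_west K \<subseteq> north_west 0"
proof
  fix b assume "b \<in> north_west K"
  then show "b \<in> north_west 0"
    using less_imp_le[OF K_pos] X_mono[of "fst b + snd b + 1 - K" "fst b + snd b + 1"]
    by (auto simp: north_west_def)
qed

lemma strip_processed_iff: "b \<in> strip P \<Longrightarrow> b \<in> processed m \<longleftrightarrow> rank b < start_time + int m"
  by (auto simp: processed_def strip_eq)

lemma processed_Suc: "processed (Suc m) = processed m \<union> {b \<in> strip P. rank b = start_time + int m}"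
  by (auto simp: processed_def strip_eq)

lemma processed_0: "processed 0 = north_west K"
  using rank_bounds(1) by (fastforce simp: processed_def strip_eq)

lemma processed_duration: "processed duration = north_west 0"
  using rank_bounds(2) north_west_subset by (fastforce simp: processed_def strip_eq)

abbreviation "frontier_at m \<equiv> frontier (processed m)"

text \<open>One stage treats all boxes of rank \<open>t\<close> at once instead of a single box, so
  that the evolution commutes with translations. A strand whose next box has another rank
  waits.\<close>

definition advance :: "(box \<Rightarrow> tile) \<Rightarrow> int \<Rightarrow> edge \<Rightarrow> edge" where
  "advance A t e =
     (if next_box e \<in> strip P \<and> rank (next_box e) = t then exit_edge (A (next_box e)) e else e)"

primrec edge_at :: "(box \<Rightarrow> tile) \<Rightarrow> nat \<Rightarrow> int \<Rightarrow> edge" where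
  "edge_at A 0 = north_edge P"
| "edge_at A (Suc m) = advance A (start_time + int m) \<circ> edge_at A m"

primrec history :: "(box \<Rightarrow> tile) \<Rightarrow> nat \<Rightarrow> int \<Rightarrow> box list" where
  "history A 0 i = []"
| "history A (Suc m) i = history A m i @
     (let b = next_box (edge_at A m i) in if b \<in> strip P \<and> rank b = start_time + int m then [b] else [])"

text \<open>The stage at which the box is traversed. Ranks in the strip are at least
  \<open>start_time\<close>, so \<open>nat\<close> cuts nothing off there.\<close>

definition time :: "box \<Rightarrow> nat" where
  "time b = nat (rank b - start_time)"

lemma time_eq: "b \<in> strip P \<Longrightarrow> int (time b) = rank b - start_time"
  using rank_bounds(1) by (simp add: time_def)

lemma advance_in_frontier:
  assumes e: "e \<in> frontier_at m"
  shows "advance A (start_time + int m) e \<in> frontier_at (Suc m)"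
proof (cases "next_box e \<in> strip P \<and> rank (next_box e) = start_time + int m")
  case False
  then show ?thesis using e by (auto simp: advance_def frontier_def processed_Suc)
next
  case True
  let ?e' = "exit_edge (A (next_box e)) e"
  have less: "rank (next_box e) < rank (next_box ?e')"
    using rank_prev_less_next[of ?e'] by simp
  \<comment> \<open>Otherwise up-left closedness would put \<open>next_box e\<close>, the box before
    \<open>?e'\<close>, into \<open>processed m\<close> as well.\<close>
  have "next_box ?e' \<notin> processed m"
    using e prev_box_in_upleft_closed[OF upleft_closed_processed, of ?e' m] by (auto simp: frontier_def)
  then show ?thesis using True less by (auto simp: advance_def frontier_def processed_Suc)
qed

lemma inj_on_advance: "inj_on (advance A (start_time + int m)) (frontier_at m)"
proof (rule inj_onI)
  let ?moves = "\<lambda>e. next_box e \<in> strip P \<and> rank (next_box e) = start_time + int m"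
  fix e e' assume e: "e \<in> frontier_at m" "e' \<in> frontier_at m"
    and eq: "advance A (start_time + int m) e = advance A (start_time + int m) e'"
  \<comment> \<open>The box behind an edge tells the two kinds apart: after the stage it lies
    outside \<open>processed m\<close> for an edge that moved and inside for one that
    waited.\<close>
  have moves: "?moves e \<longleftrightarrow> ?moves e'"
    using e eq by (auto simp: advance_def frontier_def dest!: arg_cong[of _ _ prev_box] split: if_splits)
  show "e = e'"
  proof (cases "?moves e")
    case True
    with eq moves have *: "exit_edge (A (next_box e)) e = exit_edge (A (next_box e')) e'"
      by (simp add: advance_def)
    then have "next_box e = next_box e'" by (metis prev_box_exit_edge)
    then show ?thesis using * exit_edge_inj by metis
  next
    case False
    moreover have "advance A (start_time + int m) d = d" if "\<not> ?moves d" for d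
      using that by (auto simp: advance_def)
    ultimately have "advance A (start_time + int m) e = e" "advance A (start_time + int m) e' = e'"
      using moves by blast+
    then show ?thesis using eq by metis
  qed
qed

text \<open>The box joins an up-left closed set at its stage, so the box before the edge is in that
  set too; having smaller rank, it was there already. Hence both entries of a box are occupied when
  it is traversed.\<close>

lemma entry_edge_in_frontier:
  assumes "next_box e \<in> strip P"
  shows "e \<in> frontier_at (time (next_box e))"
proof -
  let ?m = "time (next_box e)"
  have "next_box e \<in> processed (Suc ?m)" using assms by (simp add: strip_processed_iff time_eq)
  then have "prev_box e \<in> processed (Suc ?m)"
    by (rule prev_box_in_upleft_closed[OF upleft_closed_processed])
  then have "prev_box e \<in> processed ?m"
    using rank_prev_less_next[of e] time_eq[OF assms] by (auto simp: processed_Suc)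
  then show ?thesis using assms by (simp add: frontier_def strip_processed_iff time_eq)
qed

text \<open>For surjectivity, an edge of the new frontier either was on the old one or leaves a box
  of the current stage; in the latter case it is reached from an entry edge of that box.\<close>

lemma bij_betw_advance:
  "bij_betw (advance A (start_time + int m)) (frontier_at m) (frontier_at (Suc m))"
proof -
  have "\<exists>e \<in> frontier_at m. advance A (start_time + int m) e = e'" if e': "e' \<in> frontier_at (Suc m)" for e'
  proof (cases "prev_box e' \<in> processed m")
    case True
    then show ?thesis using e' by (intro bexI[of _ e']) (auto simp: advance_def frontier_def processed_Suc)
  next
    case False
    then have b: "prev_box e' \<in> strip P" "rank (prev_box e') = start_time + int m"
      using e' by (auto simp: frontier_def processed_Suc)
    obtain e where e: "exit_edge (A (prev_box e')) e = e'" "next_box e = prev_box e'"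
      by (rule exit_edge_surj)
    have "time (next_box e) = m" using b e by (simp add: time_def)
    then have "e \<in> frontier_at m" using entry_edge_in_frontier[of e] e b by simp
    then show ?thesis using e b by (intro bexI[of _ e]) (simp_all add: advance_def)
  qed
  then have "advance A (start_time + int m) ` frontier_at m = frontier_at (Suc m)"
    using advance_in_frontier by blast
  then show ?thesis using inj_on_advance by (simp add: bij_betw_def)
qed

lemma bij_betw_edge_at: "bij_betw (edge_at A m) UNIV (frontier_at m)"
proof (induction m)
  case 0
  have "pos (north_edge P i) = i - 1 + K" for i by (simp add: north_edge_eq)
  then have "inj (\<lambda>i. pos (north_edge P i))" by (simp add: inj_def)
  then have "inj (north_edge P)" by (simp add: inj_def)
  then show ?case by (simp add: bij_betw_def processed_0 frontier_north)
next
  case (Suc m)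
  then show ?case unfolding edge_at.simps by (rule bij_betw_trans) (rule bij_betw_advance)
qed

lemma edge_at_in_frontier: "edge_at A m i \<in> frontier_at m"
  using bij_betw_edge_at[of A m] by (auto simp: bij_betw_def)

lemma inj_edge_at: "edge_at A m i = edge_at A m j \<longleftrightarrow> i = j"
  using bij_betw_edge_at[of A m] by (auto simp: bij_betw_def inj_def)

text \<open>Consequently \<open>pos\<close> orders the strands linearly at every stage.\<close>

lemma inj_pos_edge_at: "pos (edge_at A m i) = pos (edge_at A m j) \<longleftrightarrow> i = j"
  using frontier_pos_inj[OF upleft_closed_processed edge_at_in_frontier edge_at_in_frontier]
    inj_edge_at by metis

lemma edge_at_cong:
  assumes "\<And>b. b \<in> strip P \<Longrightarrow> rank b < start_time + int m \<Longrightarrow> A b = A' b"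
  shows "edge_at A m = edge_at A' m"
  using assms by (induction m) (auto simp: fun_eq_iff advance_def)

section \<open>Agreement of the evolution with the inductively defined strands\<close>

lemma strand_edge_at: "strand P A i (history A m i) (edge_at A m i)"
  by (induction m) (auto simp: advance_def Let_def intro: strand.intros)

lemma edge_at_stay:
  assumes "m \<le> m'" "next_box (edge_at A m i) \<in> strip P \<Longrightarrow> start_time + int m' \<le> rank (next_box (edge_at A m i))"
  shows "edge_at A m' i = edge_at A m i \<and> history A m' i = history A m i"
  using assms
proof (induction m' rule: dec_induct)
  case (step l)
  have "start_time + int l \<le> rank (next_box (edge_at A m i))" if "next_box (edge_at A m i) \<in> strip P"
    using step.prems that by simp
  then have *: "edge_at A l i = edge_at A m i" "history A l i = history A m i"
    using step.IH by simp_all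
  show ?case using step.prems by (auto simp: * advance_def Let_def)
qed simp

lemma rank_next_box_edge_at: "next_box (edge_at A m i) \<in> strip P \<Longrightarrow> start_time + int m \<le> rank (next_box (edge_at A m i))"
  using edge_at_in_frontier[of A m i] by (auto simp: frontier_def strip_processed_iff)

lemma edge_at_time:
  assumes "next_box (edge_at A m i) = b" "b \<in> strip P"
  shows "edge_at A (time b) i = edge_at A m i \<and> history A (time b) i = history A m i"
  using assms rank_next_box_edge_at[of A m i] time_eq[of b] by (intro edge_at_stay) auto

text \<open>A strand may have to wait before its next box, so the stage is moved forward to the time
  of that box before each step.\<close>

lemma strand_imp_edge_at: "strand P A i bs e \<Longrightarrow> \<exists>m. edge_at A m i = e \<and> history A m i = bs"
proof (induction rule: strand.induct)
  case strand_start
  show ?case by (intro exI[of _ 0]) simp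
next
  case (strand_step bs e)
  then obtain m where m: "edge_at A m i = e" "history A m i = bs" by blast
  let ?m = "time (next_box e)"
  have "edge_at A ?m i = e \<and> history A ?m i = bs"
    using edge_at_time[of A m i] m strand_step by auto
  then show ?case using strand_step time_eq[of "next_box e"]
    by (intro exI[of _ "Suc ?m"]) (simp add: advance_def Let_def)
qed

lemma strand_entering_iff:
  assumes "next_box e \<in> strip P"
  shows "strand P A i bs e \<longleftrightarrow> edge_at A (time (next_box e)) i = e \<and> bs = history A (time (next_box e)) i"
proof
  assume "strand P A i bs e"
  then obtain m where "edge_at A m i = e" "history A m i = bs" using strand_imp_edge_at by blast
  then show "edge_at A (time (next_box e)) i = e \<and> bs = history A (time (next_box e)) i"
    using edge_at_time[of A m i] assms by auto
qed (metis strand_edge_at)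

section \<open>The strand permutation\<close>

definition strand_perm :: "(box \<Rightarrow> tile) \<Rightarrow> int \<Rightarrow> int" where
  "strand_perm A i = pos (edge_at A duration i) + 1"

lemma pos_south_edge: "pos (south_edge P i) = i - 1"
  by (simp add: south_edge_eq)

text \<open>The last frontier is the southern boundary, whose edge \<open>j\<close> starts on
  antidiagonal \<open>j - 1\<close>; this explains the \<open>+ 1\<close> in
  \<open>strand_perm\<close>.\<close>

lemma edge_at_duration: "edge_at A duration i = south_edge P (strand_perm A i)"
  using edge_at_in_frontier[of A duration i] pos_south_edge
  by (auto simp: processed_duration frontier_south strand_perm_def)

lemma next_box_south_edge: "next_box (south_edge P i) \<notin> strip P"
  using frontier_south by (auto simp: frontier_def strip_eq)

lemma is_strand_perm_iff: "is_strand_perm P A f \<longleftrightarrow> f = strand_perm A"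
proof
  assume f: "is_strand_perm P A f"
  show "f = strand_perm A"
  proof
    fix i
    obtain m where m: "edge_at A m i = south_edge P (f i)"
      using f strand_imp_edge_at unfolding is_strand_perm_def by blast
    \<comment> \<open>No box of the strip follows a southern edge, so a strand that has reached one
      stays there; both exits can be compared at a common late stage.\<close>
    have "edge_at A (max m duration) i = south_edge P (f i)"
      using edge_at_stay[of m "max m duration" A i] m next_box_south_edge[of "f i"] by simp
    moreover have "edge_at A (max m duration) i = south_edge P (strand_perm A i)"
      using edge_at_stay[of duration "max m duration" A i] edge_at_duration[of A i]
        next_box_south_edge[of "strand_perm A i"] by simp
    ultimately have "south_edge P (f i) = south_edge P (strand_perm A i)" by simp
    then have "pos (south_edge P (f i)) = pos (south_edge P (strand_perm A i))" by simp
    then show "f i = strand_perm A i" unfolding pos_south_edge by simp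
  qed
next
  assume f: "f = strand_perm A"
  have "strand P A i (history A duration i) (south_edge P (f i))" for i
    using strand_edge_at[of A i duration] by (simp only: f edge_at_duration)
  then show "is_strand_perm P A f" unfolding is_strand_perm_def by blast
qed

section \<open>The two strands through a box and their crossings\<close>

definition visitor :: "(box \<Rightarrow> tile) \<Rightarrow> edge \<Rightarrow> int" where
  "visitor A e = (THE i. edge_at A (time (next_box e)) i = e)"

text \<open>At the stage of the box behind it, the edge lies on the frontier, which the strands
  occupy bijectively; so the description in \<open>visitor\<close> is proper.\<close>

lemma visitor_iff:
  assumes "next_box e \<in> strip P"
  shows "edge_at A (time (next_box e)) i = e \<longleftrightarrow> visitor A e = i"
proof -
  have "\<exists>i. edge_at A (time (next_box e)) i = e"
    using entry_edge_in_frontier[OF assms] bij_betw_edge_at[of A "time (next_box e)"]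
    unfolding bij_betw_def by (metis imageE)
  then obtain j where j: "edge_at A (time (next_box e)) j = e" by blast
  have iff: "edge_at A (time (next_box e)) i = e \<longleftrightarrow> i = j" for i
    using inj_edge_at[of A "time (next_box e)" i j] unfolding j .
  show ?thesis unfolding visitor_def iff by auto
qed

abbreviation left_strand :: "(box \<Rightarrow> tile) \<Rightarrow> box \<Rightarrow> int" where
  "left_strand A b \<equiv> visitor A (Up, b)"

abbreviation top_strand :: "(box \<Rightarrow> tile) \<Rightarrow> box \<Rightarrow> int" where
  "top_strand A b \<equiv> visitor A (Right, fst b, snd b + 1)"

lemma left_strand_iff: "b \<in> strip P \<Longrightarrow> edge_at A (time b) i = (Up, b) \<longleftrightarrow> left_strand A b = i"
  using visitor_iff[of "(Up, b)" A i] by (cases b) simp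

lemma top_strand_iff: "b \<in> strip P \<Longrightarrow> edge_at A (time b) i = (Right, fst b, snd b + 1) \<longleftrightarrow> top_strand A b = i"
  using visitor_iff[of "(Right, fst b, snd b + 1)" A i] by simp

lemma left_neq_top: "b \<in> strip P \<Longrightarrow> left_strand A b \<noteq> top_strand A b"
  using left_strand_iff[of b A "left_strand A b"] top_strand_iff[of b A "left_strand A b"] by auto

lemma next_box_edge_at_time:
  "b \<in> strip P \<Longrightarrow> next_box (edge_at A (time b) i) = b \<longleftrightarrow> left_strand A b = i \<or> top_strand A b = i"
  using left_strand_iff[of b A i] top_strand_iff[of b A i] next_box_eq_iff[of _ "fst b" "snd b"] by auto

lemma rank_less_Suc:
  "rank b < start_time + int (Suc m) \<longleftrightarrow> rank b < start_time + int m \<or> rank b = start_time + int m"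
  by auto

lemma set_history:
  "set (history A m i) =
     {b \<in> strip P. rank b < start_time + int m \<and> (left_strand A b = i \<or> top_strand A b = i)}"
proof (induction m)
  case 0
  then show ?case using rank_bounds(1) by fastforce
next
  case (Suc m)
  have *: "left_strand A b = i \<or> top_strand A b = i \<longleftrightarrow> b = next_box (edge_at A m i)"
    if "b \<in> strip P" "rank b = start_time + int m" for b
    using next_box_edge_at_time[of b A i] that by (auto simp: time_def)
  have "set (history A (Suc m) i) = set (history A m i) \<union>
     {b \<in> strip P. rank b = start_time + int m \<and> b = next_box (edge_at A m i)}"
    by (auto simp: Let_def)
  also have "\<dots> = set (history A m i) \<union>
     {b \<in> strip P. rank b = start_time + int m \<and> (left_strand A b = i \<or> top_strand A b = i)}"
    using * by blast
  finally have step: "set (history A (Suc m) i) = \<dots>" .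
  show ?case unfolding step Suc rank_less_Suc by blast
qed

text \<open>Only crossings of one direction are collected, in which \<open>i\<close> enters from the
  left and thereby overtakes \<open>j\<close> in the order by \<open>pos\<close>.\<close>

definition crossed :: "(box \<Rightarrow> tile) \<Rightarrow> nat \<Rightarrow> int \<Rightarrow> int \<Rightarrow> box set" where
  "crossed A m i j = {b \<in> strip P. rank b < start_time + int m \<and> A b = Crossing
     \<and> left_strand A b = i \<and> top_strand A b = j}"

lemma finite_crossed: "finite (crossed A m i j)"
proof (rule finite_subset)
  show "crossed A m i j \<subseteq> set (history A m i)" by (auto simp: crossed_def set_history)
qed simp

lemma crossings_between_history:
  assumes "i \<noteq> j"
  shows "crossings_between A (history A m i) (history A m j) = card (crossed A m i j) + card (crossed A m j i)"
proof -
  have "{b \<in> set (history A m i) \<inter> set (history A m j). A b = Crossing} = crossed A m i j \<union> crossed A m j i"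
    using assms by (auto simp: crossed_def set_history)
  moreover have "crossed A m i j \<inter> crossed A m j i = {}" using assms by (auto simp: crossed_def)
  ultimately show ?thesis unfolding crossings_between_def
    by (simp add: card_Un_disjoint finite_crossed)
qed

definition crossing_now :: "(box \<Rightarrow> tile) \<Rightarrow> nat \<Rightarrow> int \<Rightarrow> int \<Rightarrow> bool" where
  "crossing_now A m i j \<longleftrightarrow> (\<exists>b \<in> strip P. rank b = start_time + int m \<and> A b = Crossing
     \<and> left_strand A b = i \<and> top_strand A b = j)"

text \<open>At most one box is added, since it must be the one in front of strand
  \<open>i\<close>.\<close>

lemma card_crossed_Suc: "card (crossed A (Suc m) i j) = card (crossed A m i j) + of_bool (crossing_now A m i j)"
proof -
  let ?N = "{b \<in> strip P. rank b = start_time + int m \<and> A b = Crossing \<and> left_strand A b = i \<and> top_strand A b = j}"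
  have N: "b = next_box (edge_at A m i)" if "b \<in> ?N" for b
    using that next_box_edge_at_time[of b A i] by (auto simp: time_def)
  have "card ?N = of_bool (crossing_now A m i j)"
  proof (cases "crossing_now A m i j")
    case True
    then obtain b where "b \<in> ?N" by (auto simp: crossing_now_def)
    then have singleton: "?N = {b}" using N by blast
    show ?thesis unfolding singleton using True by simp
  next
    case False
    then have empty: "?N = {}" by (auto simp: crossing_now_def)
    show ?thesis unfolding empty using False by simp
  qed
  moreover have Un: "crossed A (Suc m) i j = crossed A m i j \<union> ?N"
    unfolding crossed_def rank_less_Suc by blast
  moreover have "crossed A m i j \<inter> ?N = {}" unfolding crossed_def by force
  moreover have "finite ?N" using finite_crossed[of A "Suc m" i j] unfolding Un by blast
  ultimately show ?thesis using finite_crossed[of A m i j] by (simp only: card_Un_disjoint)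
qed

lemma crossing_nowD:
  assumes "crossing_now A m i j"
  shows "pos (edge_at A m i) < pos (edge_at A m j)" "pos (edge_at A (Suc m) j) < pos (edge_at A (Suc m) i)"
proof -
  obtain b where b: "b \<in> strip P" "rank b = start_time + int m" "A b = Crossing"
    "left_strand A b = i" "top_strand A b = j" using assms by (auto simp: crossing_now_def)
  then have "time b = m" by (simp add: time_def)
  then have e: "edge_at A m i = (Up, b)" "edge_at A m j = (Right, fst b, snd b + 1)"
    using left_strand_iff[of b A i] top_strand_iff[of b A j] b by auto
  then show "pos (edge_at A m i) < pos (edge_at A m j)" by simp
  show "pos (edge_at A (Suc m) j) < pos (edge_at A (Suc m) i)"
    using e b by (simp add: advance_def)
qed

lemma pos_advance:
  "pos e - 1 \<le> pos (advance A t e)" "pos (advance A t e) \<le> pos e + 1"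
  "pos e < pos (advance A t e) \<Longrightarrow>
     \<exists>b \<in> strip P. rank b = t \<and> A b = Crossing \<and> e = (Up, b)"
  "pos (advance A t e) < pos e \<Longrightarrow>
     \<exists>b \<in> strip P. rank b = t \<and> A b = Crossing \<and> e = (Right, fst b, snd b + 1)"
  by (cases "(A (next_box e), e)" rule: exit_edge.cases; auto simp: advance_def split: if_splits)+

text \<open>Positions change by at most one per stage, so two strands that swap were adjacent and
  the lower one rose through a crossing. The top edge of that crossing box has the position of the
  other strand, which therefore sits on it.\<close>

lemma pos_swap_imp_crossing:
  assumes less: "pos (edge_at A m i) < pos (edge_at A m j)"
    and swap: "pos (edge_at A (Suc m) j) < pos (edge_at A (Suc m) i)"
  shows "crossing_now A m i j"
proof -
  let ?t = "start_time + int m"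
  note bounds = pos_advance(1)[of "edge_at A m j" A ?t] pos_advance(2)[of A ?t "edge_at A m i"]
  have "pos (edge_at A m i) < pos (advance A ?t (edge_at A m i))"
    using bounds less swap by simp
  then obtain b where b: "b \<in> strip P" "rank b = ?t" "A b = Crossing" "edge_at A m i = (Up, b)"
    using pos_advance(3) by blast
  have time: "time b = m" using b by (simp add: time_def)
  have "pos (edge_at A m j) = pos (Right, fst b, snd b + 1)"
    using bounds less swap b(4) by simp
  moreover have "(Right, fst b, snd b + 1) \<in> frontier_at m"
    using entry_edge_in_frontier[of "(Right, fst b, snd b + 1)"] b time by simp
  ultimately have "edge_at A m j = (Right, fst b, snd b + 1)"
    using frontier_pos_inj[OF upleft_closed_processed edge_at_in_frontier] by blast
  then show ?thesis unfolding crossing_now_def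
    using b time left_strand_iff[of b A i] top_strand_iff[of b A j] by auto
qed

text \<open>Every crossing of the two strands reverses their order, so the two directions alternate.
  As the strands start in order, the excess is 1 or 0 according to whether they are now out of
  order.\<close>

lemma card_crossed_diff:
  assumes "i < j"
  shows "int (card (crossed A m i j)) - int (card (crossed A m j i)) =
    of_bool (pos (edge_at A m j) < pos (edge_at A m i))"
proof (induction m)
  case 0
  have "crossed A 0 i j = {}" for i j using rank_bounds(1) by (fastforce simp: crossed_def)
  then show ?case using assms by (simp add: north_edge_eq)
next
  case (Suc m)
  have ne: "pos (edge_at A l j) \<noteq> pos (edge_at A l i)" for l
    using inj_pos_edge_at[of A l j i] assms by simp
  have now: "crossing_now A m i j \<longleftrightarrow> pos (edge_at A m i) < pos (edge_at A m j) \<and>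
      pos (edge_at A (Suc m) j) < pos (edge_at A (Suc m) i)" for i j
    using crossing_nowD pos_swap_imp_crossing by blast
  show ?case
    using Suc ne[of m] ne[of "Suc m"] unfolding card_crossed_Suc now[of i j] now[of j i]
    by (cases "pos (edge_at A m i) < pos (edge_at A m j)";
        cases "pos (edge_at A (Suc m) i) < pos (edge_at A (Suc m) j)") (simp_all del: edge_at.simps)
qed

text \<open>The total number of crossings has the parity of the difference computed in
  \<open>card_crossed_diff\<close>.\<close>

lemma odd_crossings_iff:
  assumes "i < j"
  shows "odd (crossings_between A (history A m i) (history A m j)) \<longleftrightarrow>
    pos (edge_at A m j) < pos (edge_at A m i)"
proof -
  have "odd (int (card (crossed A m i j)) + int (card (crossed A m j i))) \<longleftrightarrow>
    odd (int (card (crossed A m i j)) - int (card (crossed A m j i)))" by simp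
  then show ?thesis using assms
    by (simp add: crossings_between_history card_crossed_diff flip: of_nat_add)
qed

section \<open>Parity of crossings and the Deogram condition\<close>

lemma crossings_between_commute: "crossings_between A bs cs = crossings_between A cs bs"
  unfolding crossings_between_def by (simp add: Int_commute)

definition rising :: "(box \<Rightarrow> tile) \<Rightarrow> box \<Rightarrow> bool" where
  "rising A b \<longleftrightarrow> left_strand A b < top_strand A b"

text \<open>The left entry of a box has the smaller \<open>pos\<close>, so the strands are in order
  on arrival exactly if the left one has the smaller label.\<close>

lemma even_crossings_iff_rising:
  assumes "b \<in> strip P" "i \<noteq> j" "{i, j} = {left_strand A b, top_strand A b}"
  shows "even (crossings_between A (history A (time b) i) (history A (time b) j)) \<longleftrightarrow> rising A b"
proof -
  let ?l = "left_strand A b" and ?r = "top_strand A b"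
  have "even (crossings_between A (history A (time b) ?l) (history A (time b) ?r)) \<longleftrightarrow> rising A b"
    using left_strand_iff[OF assms(1), of A ?l] top_strand_iff[OF assms(1), of A ?r]
      odd_crossings_iff[of ?l ?r A "time b"] odd_crossings_iff[of ?r ?l A "time b"] left_neq_top[OF assms(1), of A]
    by (cases "?l < ?r") (auto simp: rising_def crossings_between_commute)
  then show ?thesis using assms(2,3) by (auto simp: doubleton_eq_iff crossings_between_commute)
qed

text \<open>A box is entered by exactly two strands, with histories fixed by the stage of the box;
  the condition on all pairs of strands thus becomes one on boxes.\<close>

lemma Deograms_iff:
  "A \<in> Deograms f P \<longleftrightarrow> A \<in> periodic_fillings P \<and> f = strand_perm A \<and>
     (\<forall>b \<in> strip P. A b = Elbow \<longrightarrow> rising A b)"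
proof -
  have "(\<forall>i j bs cs d e. i \<noteq> j \<longrightarrow> strand P A i bs d \<longrightarrow> strand P A j cs e \<longrightarrow>
        next_box d = next_box e \<longrightarrow> next_box d \<in> strip P \<longrightarrow> A (next_box d) = Elbow \<longrightarrow>
        even (crossings_between A bs cs)) \<longleftrightarrow> (\<forall>b \<in> strip P. A b = Elbow \<longrightarrow> rising A b)" (is "?L \<longleftrightarrow> ?R")
  proof
    assume L: ?L
    show ?R
    proof (intro ballI impI)
      fix b assume b: "b \<in> strip P" "A b = Elbow"
      let ?l = "left_strand A b" and ?r = "top_strand A b"
      have "next_box (edge_at A (time b) ?l) = b" "next_box (edge_at A (time b) ?r) = b"
        using next_box_edge_at_time b by auto
      then have "even (crossings_between A (history A (time b) ?l) (history A (time b) ?r))"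
        using L[rule_format, OF left_neq_top[OF b(1)] strand_edge_at strand_edge_at] b by auto
      then show "rising A b" using even_crossings_iff_rising[OF b(1)] left_neq_top[OF b(1)] by blast
    qed
  next
    assume R: ?R
    show ?L
    proof (intro allI impI)
      fix i j bs cs d e
      assume a: "i \<noteq> j" "strand P A i bs d" "strand P A j cs e" "next_box d = next_box e"
        "next_box d \<in> strip P" "A (next_box d) = Elbow"
      let ?b = "next_box d"
      have d: "edge_at A (time ?b) i = d" "bs = history A (time ?b) i"
        "edge_at A (time ?b) j = e" "cs = history A (time ?b) j"
        using a strand_entering_iff[of d A i bs] strand_entering_iff[of e A j cs] by auto
      then have "{i, j} = {left_strand A ?b, top_strand A ?b}"
        using next_box_edge_at_time[OF a(5), of A i] next_box_edge_at_time[OF a(5), of A j] a by auto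
      then show "even (crossings_between A bs cs)"
        using even_crossings_iff_rising[OF a(5,1)] R a d by simp
    qed
  qed
  then show ?thesis by (auto simp: Deograms_def is_strand_perm_iff)
qed

section \<open>Periodicity and counting\<close>

lemma time_shift [simp]: "time (shift_box P m b) = time b"
  by (simp add: time_def)

lemma periodic_shift:
  assumes A: "A \<in> periodic_fillings P" and b: "b \<in> strip P"
  shows "A (shift_box P m b) = A b"
proof -
  have one: "A (shift_box P 1 c) = A c" if "c \<in> strip P" for c
    using A that by (cases c) (auto simp: periodic_fillings_def)
  show ?thesis
  proof (induction m rule: int_induct[where k = 0])
    case (step1 m)
    then show ?case using one[of "shift_box P m b"] b by (simp add: strip_shift shift_box_add add.commute)
  next
    case (step2 m)
    then show ?case using one[of "shift_box P (m - 1) b"] b by (simp add: strip_shift shift_box_add)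
  qed simp
qed

lemma edge_at_shift:
  assumes "A \<in> periodic_fillings P"
  shows "edge_at A m (i + j * N) = shift_edge P j (edge_at A m i)"
proof (induction m)
  case 0
  show ?case by (simp add: north_edge_shift)
next
  case (Suc m)
  then show ?case using periodic_shift[OF assms] by (simp add: advance_def strip_shift)
qed

lemma visitor_shift:
  assumes "A \<in> periodic_fillings P" "next_box e \<in> strip P"
  shows "visitor A (shift_edge P j e) = visitor A e + j * N"
proof -
  have "edge_at A (time (next_box e)) (visitor A e) = e" using visitor_iff[OF assms(2)] by blast
  then have "edge_at A (time (next_box e)) (visitor A e + j * N) = shift_edge P j e"
    using edge_at_shift[OF assms(1)] by simp
  then show ?thesis using visitor_iff[of "shift_edge P j e" A] assms(2) by (simp add: strip_shift)
qed

lemma left_top_strand_shift: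
  assumes "A \<in> periodic_fillings P" "b \<in> strip P"
  shows "left_strand A (shift_box P j b) = left_strand A b + j * N"
    and "top_strand A (shift_box P j b) = top_strand A b + j * N"
  using visitor_shift[OF assms(1), of "(Up, b)" j] visitor_shift[OF assms(1), of "(Right, fst b, snd b + 1)" j] assms(2)
  by (cases b; simp add: shift_edge_Pair algebra_simps)+

lemma rising_shift:
  "A \<in> periodic_fillings P \<Longrightarrow> b \<in> strip P \<Longrightarrow> rising A (shift_box P j b) \<longleftrightarrow> rising A b"
  by (simp add: rising_def left_top_strand_shift)

text \<open>The labels of both visitors grow by \<open>N\<close> under translation and the column
  grows by \<open>W\<close>, so each of the three can select one box per orbit.\<close>

lemma card_classes:
  assumes S: "S \<subseteq> strip P" "\<And>b m. b \<in> S \<Longrightarrow> shift_box P m b \<in> S" and A: "A \<in> periodic_fillings P"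
  shows "card (S // translation_rel P) = card {b \<in> S. left_strand A b \<in> {1..N}}"
    and "card (S // translation_rel P) = card {b \<in> S. top_strand A b \<in> {1..N}}"
    and "card (S // translation_rel P) = card {b \<in> S. 0 \<le> fst b \<and> fst b < W}"
proof -
  have S': "(x + m * W, y + m * K) \<in> S" if "(x, y) \<in> S" for x y m using S(2)[OF that] by simp
  have L: "left_strand A (x + m * W, y + m * K) = left_strand A (x, y) + m * N"
    and T: "top_strand A (x + m * W, y + m * K) = top_strand A (x, y) + m * N" if "(x, y) \<in> S" for x y m
    using left_top_strand_shift[OF A, of "(x, y)" m] S(1) that by auto
  have "card (S // translation_rel P) = card {b \<in> S. 1 \<le> left_strand A b \<and> left_strand A b < 1 + N}"
    by (rule card_translation_classes, rule N_pos, erule S', erule L)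
  then show "card (S // translation_rel P) = card {b \<in> S. left_strand A b \<in> {1..N}}"
    by (simp add: zless_add1_eq le_less add.commute[of 1])
  have "card (S // translation_rel P) = card {b \<in> S. 1 \<le> top_strand A b \<and> top_strand A b < 1 + N}"
    by (rule card_translation_classes, rule N_pos, erule S', erule T)
  then show "card (S // translation_rel P) = card {b \<in> S. top_strand A b \<in> {1..N}}"
    by (simp add: zless_add1_eq le_less add.commute[of 1])
  have "card (S // translation_rel P) = card {b \<in> S. 0 \<le> fst b \<and> fst b < 0 + W}"
    by (rule card_translation_classes, rule W_pos, erule S') simp
  then show "card (S // translation_rel P) = card {b \<in> S. 0 \<le> fst b \<and> fst b < W}" by simp
qed

section \<open>Strand permutations are bounded affine permutations\<close>

lemma sum_pos_edge_at_Suc: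
  assumes A: "A \<in> periodic_fillings P"
  shows "(\<Sum>i\<in>{1..N}. pos (edge_at A (Suc m) i)) = (\<Sum>i\<in>{1..N}. pos (edge_at A m i))"
proof -
  define S where "S = {b \<in> strip P. rank b = start_time + int m \<and> A b = Crossing}"
  let ?L = "left_strand A" and ?T = "top_strand A"
  have S_strip: "S \<subseteq> strip P" by (auto simp: S_def)
  have S_shift: "shift_box P m' b \<in> S" if "b \<in> S" for m' b
    using that periodic_shift[OF A] by (auto simp: S_def strip_shift)
  have time: "time b = m" if "b \<in> S" for b using that by (simp add: S_def time_def)
  have edges: "edge_at A m i = (Up, b) \<longleftrightarrow> ?L b = i" "edge_at A m i = (Right, fst b, snd b + 1) \<longleftrightarrow> ?T b = i"
    if "b \<in> S" for b i
    using left_strand_iff[of b A i] top_strand_iff[of b A i] time[OF that] that S_strip by auto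
  have inj: "inj_on ?L S" "inj_on ?T S"
    by (rule inj_onI; metis edges prod.inject prod_eqI add_right_cancel)+
  \<comment> \<open>During one stage only crossings change positions: the left strand gains 1 and
    the top strand loses 1.\<close>
  have delta: "pos (edge_at A (Suc m) i) - pos (edge_at A m i) = of_bool (i \<in> ?L ` S) - of_bool (i \<in> ?T ` S)" for i
  proof -
    let ?e = "edge_at A m i" and ?t = "start_time + int m"
    have up: "?e = (Up, b) \<and> pos (edge_at A (Suc m) i) = pos ?e + 1" if "b \<in> S" "?L b = i" for b
      using edges(1)[OF that(1), of i] that by (auto simp: S_def advance_def)
    have down: "?e = (Right, fst b, snd b + 1) \<and> pos (edge_at A (Suc m) i) = pos ?e - 1" if "b \<in> S" "?T b = i" for b
      using edges(2)[OF that(1), of i] that by (auto simp: S_def advance_def)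
    have same: "pos (edge_at A (Suc m) i) = pos ?e" if "i \<notin> ?L ` S" "i \<notin> ?T ` S"
    proof (rule ccontr)
      assume "pos (edge_at A (Suc m) i) \<noteq> pos ?e"
      then consider "pos ?e < pos (advance A ?t ?e)" | "pos (advance A ?t ?e) < pos ?e" by force
      then obtain b where b: "b \<in> S" "?e = (Up, b) \<or> ?e = (Right, fst b, snd b + 1)"
        using pos_advance(3)[of ?e A ?t] pos_advance(4)[of A ?t ?e] by cases (auto simp: S_def)
      then show False using edges[OF b(1), of i] that by auto
    qed
    show ?thesis
    proof (cases "i \<in> ?L ` S")
      case True
      then obtain b where b: "b \<in> S" "?L b = i" by blast
      have "i \<notin> ?T ` S"
      proof
        assume "i \<in> ?T ` S"
        then obtain c where c: "c \<in> S" "?T c = i" by blast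
        show False using up[OF b] down[OF c] by simp
      qed
      then show ?thesis using up[OF b] True by (simp del: edge_at.simps)
    next
      case L: False
      show ?thesis
      proof (cases "i \<in> ?T ` S")
        case True
        then obtain b where b: "b \<in> S" "?T b = i" by blast
        show ?thesis using down[OF b] True L by (simp del: edge_at.simps)
      next
        case False
        then show ?thesis using same L by (simp del: edge_at.simps)
      qed
    qed
  qed
  have count: "(\<Sum>i\<in>{1..N}. of_bool (i \<in> g ` S)) = int (card {b \<in> S. g b \<in> {1..N}})"
    if "inj_on g S" for g :: "box \<Rightarrow> int"
  proof -
    have "(\<Sum>i\<in>{1..N}. of_bool (i \<in> g ` S)) = int (card ({1..N} \<inter> g ` S))"
      by (simp add: of_bool_def flip: sum.inter_restrict)
    also have "{1..N} \<inter> g ` S = g ` {b \<in> S. g b \<in> {1..N}}" by blast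
    also have "card \<dots> = card {b \<in> S. g b \<in> {1..N}}"
      by (rule card_image) (rule inj_on_subset[OF that], blast)
    finally show ?thesis .
  qed
  \<comment> \<open>Gains and losses over one period cancel, because both are counted by the orbits
    of crossing boxes of this stage.\<close>
  have "(\<Sum>i\<in>{1..N}. pos (edge_at A (Suc m) i) - pos (edge_at A m i)) = 0"
    unfolding delta sum_subtractf count[OF inj(1)] count[OF inj(2)]
    using card_classes[OF S_strip S_shift A] by simp
  then show ?thesis by (simp only: sum_subtractf)
qed

text \<open>The sum of the positions over one period is preserved by every stage. Northern edge
  \<open>i\<close> has position \<open>i - 1 + K\<close>, so the mean displacement is
  \<open>K\<close>.\<close>

lemma sum_strand_perm:
  assumes "A \<in> periodic_fillings P"
  shows "(\<Sum>i\<in>{1..N}. strand_perm A i - i) = N * K"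
proof -
  have "(\<Sum>i\<in>{1..N}. pos (edge_at A m i)) = (\<Sum>i\<in>{1..N}. i - 1 + K)" for m
  proof (induction m)
    case 0
    show ?case by (intro sum.cong) (simp_all add: north_edge_eq)
  next
    case (Suc m)
    then show ?case by (simp only: sum_pos_edge_at_Suc[OF assms])
  qed
  then show ?thesis by (simp add: strand_perm_def sum_subtractf sum.distrib algebra_simps)
qed

text \<open>Strands move only right and down. The alternative with \<open>north_edge P i\<close>
  accounts for a strand that has not traversed any box yet.\<close>

lemma edge_at_region:
  fixes A i
  defines "b \<equiv> next_box (north_edge P i)"
  shows "fst b \<le> fst (next_box (edge_at A m i)) \<and> snd (next_box (edge_at A m i)) \<le> snd b \<and>
    (edge_at A m i = north_edge P i \<or>
      fst b \<le> fst (prev_box (edge_at A m i)) \<and> snd (prev_box (edge_at A m i)) \<le> snd b)"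
proof (induction m)
  case 0
  show ?case by (simp add: b_def)
next
  case (Suc m)
  then show ?case
    using next_prev_box_mono[of "exit_edge (A (next_box (edge_at A m i))) (edge_at A m i)"]
    by (auto simp: advance_def)
qed

text \<open>The last box traversed lies weakly right of and below the first one. Comparing columns
  gives the lower bound, comparing rows the upper one.\<close>

lemma strand_perm_bounds: "i \<le> strand_perm A i" "strand_perm A i \<le> i + N"
proof -
  define j where "j = strand_perm A i"
  have j: "edge_at A duration i = south_edge P j" by (simp add: edge_at_duration j_def)
  consider "south_edge P j = north_edge P i"
    | "fst (next_box (north_edge P i)) \<le> fst (prev_box (south_edge P j))"
      "snd (prev_box (south_edge P j)) \<le> snd (next_box (north_edge P i))"
    using edge_at_region[of i A duration] unfolding j by blast
  then have "i \<le> j \<and> j \<le> i + N"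
  proof cases
    case 1
    then have "pos (south_edge P j) = pos (north_edge P i)" by simp
    then have "j = i + K" by (simp add: south_edge_eq north_edge_eq)
    then show ?thesis using less_imp_le[OF K_pos] less_imp_le[OF W_pos] N_eq by simp
  next
    case 2
    have "fst (next_box (north_edge P i)) = X (i - 1)" "snd (next_box (north_edge P i)) = Y i + K - 1"
      "fst (prev_box (south_edge P j)) = X j - 1" "snd (prev_box (south_edge P j)) = Y (j - 1)"
      using ext_step_iff[of i] ext_step_iff[of j] X_plus_Y[of i] X_plus_Y[of "j - 1"]
      by (cases "ext_step P i"; cases "ext_step P j"; simp add: north_edge_eq south_edge_eq)+
    then have "X (i - 1) < X j" "Y (j - 1) < Y (i + 1 * N)"
      using 2 vertex_shift[of i 1] by simp_all
    then have "\<not> j \<le> i - 1" "\<not> i + N \<le> j - 1"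
      using X_mono[of j "i - 1"] Y_mono[of "i + 1 * N" "j - 1"] by auto
    then show ?thesis by simp
  qed
  then show "i \<le> strand_perm A i" "strand_perm A i \<le> i + N" by (simp_all add: j_def)
qed

lemma bij_strand_perm: "bij (strand_perm A)"
proof (rule bijI)
  show "inj (strand_perm A)" using inj_pos_edge_at by (simp add: inj_def strand_perm_def)
  have "\<exists>i. j = strand_perm A i" for j
  proof -
    have "south_edge P j \<in> range (edge_at A duration)"
      using bij_betw_edge_at[of A duration] by (simp add: bij_betw_def processed_duration frontier_south)
    then obtain i where "south_edge P j = edge_at A duration i" by blast
    then have "pos (south_edge P j) = pos (edge_at A duration i)" by simp
    then show ?thesis unfolding pos_south_edge strand_perm_def by (intro exI[of _ i]) simp
  qed
  then show "surj (strand_perm A)" by (simp add: surj_def)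
qed

lemma strand_perm_in_bounded_affine_perms:
  assumes A: "A \<in> periodic_fillings P"
  shows "strand_perm A \<in> bounded_affine_perms (count_list P Up) (length P)"
proof -
  have shift: "strand_perm A (i + N) = strand_perm A i + N" for i
    using edge_at_shift[OF A, of duration i 1] N_eq by (simp add: strand_perm_def)
  have "(\<Sum>i\<in>{1..N}. real_of_int (strand_perm A i - i)) = real_of_int (N * K)"
    unfolding sum_strand_perm[OF A, symmetric] by simp
  then have "(1 / real (length P)) * (\<Sum>i = 1..N. real_of_int (strand_perm A i - i)) = real (count_list P Up)"
    using N_pos by (simp add: height_def)
  then show ?thesis
    using bij_strand_perm shift strand_perm_bounds unfolding bounded_affine_perms_def by blast
qed

text \<open>Crossings are grouped by pairs of strands \<open>i < j\<close>. Rising ones form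
  \<open>crossed\<close> of \<open>i\<close> and \<open>j\<close>, the others \<open>crossed\<close>
  of \<open>j\<close> and \<open>i\<close>, and the excess is 1 exactly if the pair is an
  inversion.\<close>

lemma card_rising_crossings:
  assumes A: "A \<in> periodic_fillings P"
  defines "U \<equiv> {b \<in> strip P. A b = Crossing \<and> rising A b}"
    and "D \<equiv> {b \<in> strip P. A b = Crossing \<and> \<not> rising A b}"
  shows "card (U // translation_rel P) = card (D // translation_rel P) + affine_length (length P) (strand_perm A)"
proof -
  let ?L = "left_strand A" and ?T = "top_strand A" and ?f = "strand_perm A"
  \<comment> \<open>The smaller label is the left one in a rising box and the top one in any other;
    requiring it to lie in one period matches \<open>affine_length\<close>.\<close>
  define U1 D1 where "U1 = {b \<in> U. ?L b \<in> {1..N}}" and "D1 = {b \<in> D. ?T b \<in> {1..N}}"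
  define Inv where "Inv = {(a, b). a \<in> {1..N} \<and> a < b \<and> ?f b < ?f a}"
  define Q where "Q = (\<lambda>b. (?L b, ?T b)) ` U1 \<union> (\<lambda>b. (?T b, ?L b)) ` D1"
  have shift: "shift_box P m b \<in> U \<longleftrightarrow> b \<in> U" "shift_box P m b \<in> D \<longleftrightarrow> b \<in> D" for m b
    using periodic_shift[OF A, of b m] rising_shift[OF A, of b m] by (auto simp: U_def D_def strip_shift)
  have fin: "finite U1" "finite D1"
  proof -
    have "U1 \<union> D1 \<subseteq> (\<Union>i\<in>{1..N}. set (history A duration i))"
      using rank_bounds(2) by (auto simp: U1_def D1_def U_def D_def set_history)
    then have "finite (U1 \<union> D1)" by (rule finite_subset) simp
    then show "finite U1" "finite D1" by auto
  qed
  have fibre_U: "{b \<in> U1. (?L b, ?T b) = (i, j)} = crossed A duration i j" if "i < j" "i \<in> {1..N}" for i j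
    using that rank_bounds(2) by (auto simp: U1_def U_def crossed_def rising_def)
  have fibre_D: "{b \<in> D1. (?T b, ?L b) = (i, j)} = crossed A duration j i" if "i < j" "i \<in> {1..N}" for i j
    using that rank_bounds(2) by (auto simp: D1_def D_def crossed_def rising_def)
  have Q: "i < j \<and> i \<in> {1..N}" if "(i, j) \<in> Q" for i j
    using that left_neq_top[of _ A] by (force simp: Q_def U1_def U_def D1_def D_def rising_def)
  have diff: "card (crossed A duration i j) = card (crossed A duration j i) + of_bool (?f j < ?f i)" if "i < j" for i j
  proof -
    have "int (card (crossed A duration i j)) = int (card (crossed A duration j i) + of_bool (?f j < ?f i))"
      using card_crossed_diff[OF that, of A duration]
      unfolding strand_perm_def add_less_cancel_right of_nat_add of_nat_of_bool by linarith
    then show ?thesis by (simp only: of_nat_eq_iff)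
  qed
  \<comment> \<open>An inverted pair has at least one crossing. Thus all inversions are indexed by
    the finite set \<open>Q\<close>.\<close>
  have "Inv \<subseteq> Q"
  proof
    fix p assume "p \<in> Inv"
    then obtain i j where ij: "p = (i, j)" "i < j" "i \<in> {1..N}" "?f j < ?f i" by (auto simp: Inv_def)
    then have "crossed A duration i j \<noteq> {}" using diff[OF ij(2)] by auto
    then show "p \<in> Q" using fibre_U[OF ij(2,3)] ij by (force simp: Q_def)
  qed
  have "finite Q" using fin by (simp add: Q_def)
  have "card U1 = (\<Sum>p\<in>Q. card {b \<in> U1. (?L b, ?T b) = p})"
    using sum.group[OF fin(1) \<open>finite Q\<close>, of "\<lambda>b. (?L b, ?T b)" "\<lambda>_. 1 :: nat"] by (simp add: Q_def)
  also have "\<dots> = (\<Sum>p\<in>Q. card {b \<in> D1. (?T b, ?L b) = p} + of_bool (p \<in> Inv))"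
  proof (intro sum.cong refl, clarify)
    fix i j assume "(i, j) \<in> Q"
    then show "card {b \<in> U1. (?L b, ?T b) = (i, j)} = card {b \<in> D1. (?T b, ?L b) = (i, j)} + of_bool ((i, j) \<in> Inv)"
      using Q[of i j] fibre_U[of i j] fibre_D[of i j] diff[of i j] by (simp add: Inv_def)
  qed
  also have "\<dots> = card D1 + card (Q \<inter> Inv)"
    using sum.group[OF fin(2) \<open>finite Q\<close>, of "\<lambda>b. (?T b, ?L b)" "\<lambda>_. 1 :: nat"] \<open>finite Q\<close>
    by (simp add: Q_def sum.distrib of_bool_def flip: sum.inter_restrict)
  also have "Q \<inter> Inv = Inv" using \<open>Inv \<subseteq> Q\<close> by blast
  also have "card Inv = affine_length (length P) ?f" by (simp add: affine_length_def Inv_def)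
  finally have "card U1 = card D1 + affine_length (length P) ?f" .
  then show ?thesis
    using card_classes(1)[of U, OF _ _ A] card_classes(2)[of D, OF _ _ A] shift
    by (simp add: U1_def D1_def) (auto simp: U_def D_def)
qed

section \<open>Factorization of the sum over fillings\<close>

definition tile_weight :: "bool \<Rightarrow> tile \<Rightarrow> int fls" where
  "tile_weight c t = (case t of Elbow \<Rightarrow> if c then q_var - 1 else 0 | Crossing \<Rightarrow> if c then 1 else q_var)"

lemma weight_eq_prod:
  assumes A: "A \<in> periodic_fillings P" and elbows: "\<And>b. b \<in> strip P \<Longrightarrow> A b = Elbow \<Longrightarrow> rising A b"
  shows "(q_var - 1) ^ num_tiles P Elbow A *
     q_half_power (int (num_tiles P Crossing A) - int (affine_length (length P) (strand_perm A))) =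
     (\<Prod>b\<in>cell. tile_weight (rising A b) (A b))"
proof -
  define d where "d = card {b \<in> cell. A b = Crossing \<and> \<not> rising A b}"
  have shift: "shift_box P m b \<in> strip P" "A (shift_box P m b) = A b" "rising A (shift_box P m b) = rising A b"
    if "b \<in> strip P" for m b
    using that periodic_shift[OF A that] rising_shift[OF A that] by (simp_all add: strip_shift)
  have classes: "card ({b \<in> strip P. \<phi> b} // translation_rel P) = card {b \<in> cell. \<phi> b}"
    if "\<And>b m. b \<in> strip P \<Longrightarrow> \<phi> b \<Longrightarrow> \<phi> (shift_box P m b)" for \<phi>
  proof -
    have "card ({b \<in> strip P. \<phi> b} // translation_rel P) =
      card {b \<in> {b \<in> strip P. \<phi> b}. 0 \<le> fst b \<and> fst b < W}"
      by (rule card_classes(3)[OF _ _ A]) (use that shift(1) in auto)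
    then show ?thesis by (simp add: cell_def conj_ac)
  qed
  have el: "num_tiles P Elbow A = card {b \<in> cell. A b = Elbow}"
    and cr: "num_tiles P Crossing A = card {b \<in> cell. A b = Crossing}"
    unfolding num_tiles_def by (rule classes; simp add: shift)+
  have "card {b \<in> cell. A b = Crossing \<and> rising A b} = d + affine_length (length P) (strand_perm A)"
    using card_rising_crossings[OF A] classes[of "\<lambda>b. A b = Crossing \<and> rising A b"]
      classes[of "\<lambda>b. A b = Crossing \<and> \<not> rising A b"] by (simp add: d_def shift)
  moreover have "card {b \<in> cell. A b = Crossing} = card {b \<in> cell. A b = Crossing \<and> rising A b} + d"
    unfolding d_def by (subst card_Un_disjoint[symmetric]) (auto simp: finite_cell intro: arg_cong[where f = card])
  \<comment> \<open>There are \<open>d\<close> non-rising crossings and \<open>d\<close> plus the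
    length rising ones, so the exponent of the square root of \<open>q\<close> is even.\<close>
  ultimately have "int (num_tiles P Crossing A) - int (affine_length (length P) (strand_perm A)) = int (2 * d)"
    by (simp add: cr)
  then have q: "q_half_power (int (num_tiles P Crossing A) - int (affine_length (length P) (strand_perm A))) = q_var ^ d"
    by (simp add: q_half_power_def q_var_def fls_X_power_conv_shift_1 fls_X_intpow_power mult.commute)
  have "(\<Prod>b\<in>cell. tile_weight (rising A b) (A b)) =
    (\<Prod>b\<in>cell. (if A b = Elbow then q_var - 1 else 1) * (if A b = Crossing \<and> \<not> rising A b then q_var else 1))"
    using elbows by (intro prod.cong refl) (auto simp: tile_weight_def cell_def split: tile.split)
  also have "\<dots> = (q_var - 1) ^ num_tiles P Elbow A * q_var ^ d"
    by (simp add: prod.distrib finite_cell el d_def flip: prod.inter_filter)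
  finally show ?thesis using q by simp
qed

definition extend :: "(box \<Rightarrow> tile) \<Rightarrow> box \<Rightarrow> tile" where
  "extend B = (\<lambda>b. if b \<in> strip P then B (shift_box P (- (fst b div W)) b) else undefined)"

lemma extend_cell: "b \<in> cell \<Longrightarrow> extend B b = B b"
  by (simp add: extend_def cell_def)

text \<open>A periodic filling is a free choice of tiles on the finite set
  \<open>cell\<close>.\<close>

lemma bij_betw_extend: "bij_betw extend (cell \<rightarrow>\<^sub>E UNIV) (periodic_fillings P)"
proof (rule bij_betw_byWitness[where f' = "\<lambda>A. restrict A cell"])
  show "\<forall>B\<in>cell \<rightarrow>\<^sub>E UNIV. restrict (extend B) cell = B"
  proof (intro ballI ext)
    fix B :: "box \<Rightarrow> tile" and b assume B: "B \<in> cell \<rightarrow>\<^sub>E UNIV"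
    show "restrict (extend B) cell b = B b"
      by (cases "b \<in> cell") (simp_all add: extend_cell PiE_arb[OF B])
  qed
  show "\<forall>A\<in>periodic_fillings P. extend (restrict A cell) = A"
  proof (intro ballI ext)
    fix A b assume A: "A \<in> periodic_fillings P"
    show "extend (restrict A cell) b = A b"
    proof (cases "b \<in> strip P")
      case True
      then show ?thesis using shift_into_cell periodic_shift[OF A True] by (simp add: extend_def)
    next
      case False
      have "A \<in> strip P \<rightarrow>\<^sub>E UNIV" using A by (simp add: periodic_fillings_def)
      then show ?thesis using PiE_arb[of A "strip P" "\<lambda>_. UNIV" b] False by (simp add: extend_def)
    qed
  qed
  show "extend ` (cell \<rightarrow>\<^sub>E UNIV) \<subseteq> periodic_fillings P"
  proof (clarsimp simp: periodic_fillings_def, intro conjI)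
    fix B
    show "extend B \<in> strip P \<rightarrow>\<^sub>E UNIV" by (auto simp: extend_def)
    show "\<forall>(x, y)\<in>strip P. extend B (x + W, y + K) = extend B (x, y)"
    proof (clarify)
      fix x y assume xy: "(x, y) \<in> strip P"
      then have "(x + W, y + K) \<in> strip P" using strip_shift[of 1 "(x, y)"] by simp
      moreover have "(x + W) div W = x div W + 1"
        by (rule div_add_self2) (use W_pos in linarith)
      ultimately show "extend B (x + W, y + K) = extend B (x, y)" using xy
        by (simp add: extend_def algebra_simps)
    qed
  qed
  show "(\<lambda>A. restrict A cell) ` periodic_fillings P \<subseteq> cell \<rightarrow>\<^sub>E UNIV" by auto
qed

text \<open>The strands arriving at a box depend only on tiles of smaller rank.\<close>

lemma rising_cong:
  assumes "b \<in> strip P" "\<And>c. c \<in> strip P \<Longrightarrow> rank c < rank b \<Longrightarrow> A c = A' c"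
  shows "rising A b = rising A' b"
proof -
  have "edge_at A (time b) = edge_at A' (time b)"
    by (rule edge_at_cong) (use assms time_eq in auto)
  then show ?thesis by (simp add: rising_def visitor_def)
qed

lemma sum_periodic_fillings:
  "(\<Sum>A\<in>periodic_fillings P. \<Prod>b\<in>cell. tile_weight (rising A b) (A b)) = q_var ^ card cell"
proof -
  have "(\<Sum>A\<in>periodic_fillings P. \<Prod>b\<in>cell. tile_weight (rising A b) (A b)) =
    (\<Sum>B\<in>cell \<rightarrow>\<^sub>E UNIV. \<Prod>b\<in>cell. tile_weight (rising (extend B) b) (B b))"
    by (subst sum.reindex_bij_betw[OF bij_betw_extend, symmetric]) (simp add: extend_cell)
  also have "\<dots> = q_var ^ card cell"
  proof (rule sum_prod_dependent_weights[where rank = rank])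
    fix B B' :: "box \<Rightarrow> tile" and b assume b: "b \<in> cell" and eq: "\<And>c. c \<in> cell \<Longrightarrow> rank c < rank b \<Longrightarrow> B c = B' c"
    show "rising (extend B) b = rising (extend B') b"
    proof (rule rising_cong)
      show "b \<in> strip P" using b by (simp add: cell_def)
      fix c assume "c \<in> strip P" "rank c < rank b"
      \<comment> \<open>Moving \<open>c\<close> into \<open>cell\<close> preserves its rank, so
        agreement on earlier boxes of \<open>cell\<close> suffices.\<close>
      then show "extend B c = extend B' c" using eq[OF shift_into_cell] by (simp add: extend_def)
    qed
  qed (auto simp: finite_cell tile_weight_def)
  finally show ?thesis .
qed

text \<open>A filling with an elbow in a non-rising box has product 0, so the sum may run over all
  periodic fillings. The condition on \<open>f\<close> inside the sum prepares for exchanging it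
  with the sum over \<open>f\<close>.\<close>

lemma R_poly_eq:
  "R_poly f P = (\<Sum>A\<in>periodic_fillings P. if f = strand_perm A then \<Prod>b\<in>cell. tile_weight (rising A b) (A b) else 0)"
proof -
  have fin: "finite (periodic_fillings P)"
    using bij_betw_finite[OF bij_betw_extend] by (simp add: finite_PiE finite_cell UNIV_tile)
  have zero: "(\<Prod>b\<in>cell. tile_weight (rising A b) (A b)) = 0"
    if A: "A \<in> periodic_fillings P" and b: "b \<in> strip P" "A b = Elbow" "\<not> rising A b" for A b
  proof -
    let ?c = "shift_box P (- (fst b div W)) b"
    have "tile_weight (rising A ?c) (A ?c) = 0"
      using b periodic_shift[OF A b(1)] rising_shift[OF A b(1)] by (simp add: tile_weight_def)
    then show ?thesis using shift_into_cell[OF b(1)] by (auto intro: prod_zero[OF finite_cell])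
  qed
  have "R_poly f P = (\<Sum>A\<in>Deograms f P. \<Prod>b\<in>cell. tile_weight (rising A b) (A b))"
    unfolding R_poly_def by (intro sum.cong refl) (auto simp: Deograms_iff weight_eq_prod)
  also have "\<dots> = (\<Sum>A\<in>periodic_fillings P. if f = strand_perm A then \<Prod>b\<in>cell. tile_weight (rising A b) (A b) else 0)"
    using zero by (intro sum.mono_neutral_cong_left fin) (auto simp: Deograms_iff)
  finally show ?thesis .
qed

text \<open>Each periodic filling occurs for exactly one \<open>f\<close>, its strand permutation,
  so the inner sum over \<open>f\<close> leaves a single product.\<close>

lemma g_poly_eq: "g_poly P = q_var ^ (count_list P Right * count_list P Up)"
proof -
  let ?B = "bounded_affine_perms (count_list P Up) (length P)"
  have fin: "finite ?B" using N_pos by (intro finite_bounded_affine_perms) linarith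
  have "g_poly P = (\<Sum>A\<in>periodic_fillings P. \<Sum>f\<in>?B.
      if f = strand_perm A then \<Prod>b\<in>cell. tile_weight (rising A b) (A b) else 0)"
    unfolding g_poly_def R_poly_eq by (rule sum.swap)
  also have "\<dots> = (\<Sum>A\<in>periodic_fillings P. \<Prod>b\<in>cell. tile_weight (rising A b) (A b))"
    using fin strand_perm_in_bounded_affine_perms by (intro sum.cong refl) (simp add: sum.delta')
  finally show ?thesis using sum_periodic_fillings card_cell by simp
qed

end

text \<open>If one kind of step is absent, all steps are of the other kind. This settles the cases
  outside \<open>proper_path\<close>.\<close>

lemma lattice_path_unique:
  assumes "P \<in> lattice_paths k n" "P' \<in> lattice_paths k n" "k = 0 \<or> n - k = 0"
  shows "P = P'"
proof -
  have "P = replicate n s" if "count_list P t = 0" "length P = n" "s \<noteq> t" for P and s t :: step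
    using that by (intro replicate_eqI) (auto simp: count_list_0_iff, metis step.exhaust)
  note replicate = this
  from assms(3) show ?thesis
  proof
    assume "k = 0"
    then show ?thesis using replicate[of P Up Right] replicate[of P' Up Right] assms(1,2)
      by (simp add: lattice_paths_def)
  next
    assume "n - k = 0"
    then show ?thesis using replicate[of P Right Up] replicate[of P' Right Up] assms(1,2)
      by (simp add: lattice_paths_def)
  qed
qed

theorem proposition5p3:
  fixes n k :: nat and P P' :: "step list"
  assumes "n \<ge> 1" and "k \<le> n"
    and "P \<in> lattice_paths k n" and "P' \<in> lattice_paths k n"
  shows "g_poly P = g_poly P'"
proof (cases "k = 0 \<or> n - k = 0")
  case True
  then show ?thesis using lattice_path_unique assms by blast
next
  case False
  then have "proper_path Q" if "Q \<in> lattice_paths k n" for Q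
    using that by unfold_locales (auto simp: lattice_paths_def)
  then have "g_poly Q = q_var ^ ((n - k) * k)" if "Q \<in> lattice_paths k n" for Q
    using that proper_path.g_poly_eq[of Q] by (simp add: lattice_paths_def)
  then show ?thesis using assms by simp
qed

end
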